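(* Let $D$ be a Prüfer domain with finite character, and let $I$ be a nonzero ideal of $D$. Then: (1) $I$ is idempotent if and only if $I$ is a product of idempotent prime ideals. (2) The following statements are equivalent: (a) $I$ is idempotent and divisorial. (b) $I$ is a product of non-maximal idempotent prime ideals. (c) $I$ is a product of divisorial idempotent prime ideals. (d) $I$ has a unique representation as the product of incomparable divisorial idempotent primes.
   Context: A Prüfer domain is an integral domain in which every nonzero finitely generated ideal is invertible. $D$ has finite character if each nonzero ideal of $D$ is contained in only finitely many maximal ideals. An ideal $I$ is idempotent if $I=I^2$. With $K$ the quotient field of $D$ and $(D:E)=\{u\in K\mid uE\subseteq D\}$, a nonzero ideal $I$ is divisorial if $I=(D:(D:I))$. "Product" means a product of finitely many ideals, the empty product being $D$. Incomparable primes $P_1,\dots,P_n$ means $P_i\not\subseteq P_j$ whenever $i\neq j$ (in particular they are pairwise distinct); uniqueness is up to the order of the factors. *)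

theory Defs
  imports "HOL-Algebra.Algebra" "HOL-Library.Multiset"
begin

text \<open>
  The quotient field of a domain is unique only up to isomorphism, so we work with an arbitrary
  field \<open>K\<close> into which \<open>R\<close> embeds via \<open>\<iota>\<close> such that every element of \<open>K\<close> is a fraction of
  elements of \<open>R\<close>. Where one usually regards \<open>R\<close> as a subring of \<open>K\<close>, we write \<open>\<iota> ` carrier R\<close>.
\<close>

locale quotient_field = R?: domain R + K?: field K
  for R :: "('a, 'm) ring_scheme" (structure)
    and K :: "('b, 'n) ring_scheme" (structure)
    and \<iota> :: "'a \<Rightarrow> 'b" +
  assumes embed_hom: "\<iota> \<in> ring_hom R K"
    and embed_inj: "inj_on \<iota> (carrier R)"
    and fraction: "x \<in> carrier K \<Longrightarrow>
      \<exists>a \<in> carrier R. \<exists>b \<in> carrier R - {\<zero>\<^bsub>R\<^esub>}. x = \<iota> a \<otimes>\<^bsub>K\<^esub> inv\<^bsub>K\<^esub> (\<iota> b)"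

text \<open>\<open>colon R K \<iota> E\<close> is \<open>(R : E)\<close>, for a subset \<open>E\<close> of the quotient field \<open>K\<close>.\<close>

definition colon ::
  "('a, 'm) ring_scheme \<Rightarrow> ('b, 'n) ring_scheme \<Rightarrow> ('a \<Rightarrow> 'b) \<Rightarrow> 'b set \<Rightarrow> 'b set" where
  "colon R K \<iota> E = {u \<in> carrier K. \<forall>e \<in> E. u \<otimes>\<^bsub>K\<^esub> e \<in> \<iota> ` carrier R}"

text \<open>
  The library's \<^const>\<open>ideal_prod\<close> is the set of all nonempty finite sums of products, for
  arbitrary sets; below it is also used in \<open>K\<close>, where it is the product of fractional ideals.
\<close>

definition invertible_ideal ::
  "('a, 'm) ring_scheme \<Rightarrow> ('b, 'n) ring_scheme \<Rightarrow> ('a \<Rightarrow> 'b) \<Rightarrow> 'a set \<Rightarrow> bool" where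
  "invertible_ideal R K \<iota> I \<longleftrightarrow>
     ideal I R \<and> ideal_prod K (\<iota> ` I) (colon R K \<iota> (\<iota> ` I)) = \<iota> ` carrier R"

definition divisorial_ideal ::
  "('a, 'm) ring_scheme \<Rightarrow> ('b, 'n) ring_scheme \<Rightarrow> ('a \<Rightarrow> 'b) \<Rightarrow> 'a set \<Rightarrow> bool" where
  "divisorial_ideal R K \<iota> I \<longleftrightarrow>
     ideal I R \<and> I \<noteq> {\<zero>\<^bsub>R\<^esub>} \<and> \<iota> ` I = colon R K \<iota> (colon R K \<iota> (\<iota> ` I))"

definition finitely_generated_ideal :: "('a, 'm) ring_scheme \<Rightarrow> 'a set \<Rightarrow> bool" where
  "finitely_generated_ideal R I \<longleftrightarrow> (\<exists>A. finite A \<and> A \<subseteq> carrier R \<and> I = Idl\<^bsub>R\<^esub> A)"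

locale pruefer_domain = quotient_field +
  assumes fg_invertible:
    "\<lbrakk>ideal I R; finitely_generated_ideal R I; I \<noteq> {\<zero>\<^bsub>R\<^esub>}\<rbrakk> \<Longrightarrow> invertible_ideal R K \<iota> I"

definition finite_character :: "('a, 'm) ring_scheme \<Rightarrow> bool" where
  "finite_character R \<longleftrightarrow>
     (\<forall>I. ideal I R \<and> I \<noteq> {\<zero>\<^bsub>R\<^esub>} \<longrightarrow> finite {M. maximalideal M R \<and> I \<subseteq> M})"

definition idempotent_ideal :: "('a, 'm) ring_scheme \<Rightarrow> 'a set \<Rightarrow> bool" where
  "idempotent_ideal R I \<longleftrightarrow> ideal I R \<and> ideal_prod R I I = I"

definition ideal_prod_list :: "('a, 'm) ring_scheme \<Rightarrow> 'a set list \<Rightarrow> 'a set" where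
  "ideal_prod_list R Is = foldr (ideal_prod R) Is (carrier R)"

text \<open>
  Comparing entries at distinct positions (rather than distinct entries) makes an incomparable
  list repetition-free.
\<close>

definition incomparable :: "'a set list \<Rightarrow> bool" where
  "incomparable Ps \<longleftrightarrow>
     (\<forall>i < length Ps. \<forall>j < length Ps. i \<noteq> j \<longrightarrow> \<not> Ps ! i \<subseteq> Ps ! j)"

definition incomparable_div_idem_prime_rep ::
  "('a, 'm) ring_scheme \<Rightarrow> ('b, 'n) ring_scheme \<Rightarrow> ('a \<Rightarrow> 'b) \<Rightarrow> 'a set \<Rightarrow> 'a set list \<Rightarrow> bool"
where
  "incomparable_div_idem_prime_rep R K \<iota> I Ps \<longleftrightarrow>
     (\<forall>P \<in> set Ps. primeideal P R \<and> idempotent_ideal R P \<and> divisorial_ideal R K \<iota> P) \<and>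
     incomparable Ps \<and> I = ideal_prod_list R Ps"

end

theory Submission
  imports Defs
begin

text \<open>
  Invertibility of \<open>(a, b)\<close> gives an \<open>e\<close> with \<open>e a \<in> b R\<close> and \<open>(1 - e) b \<in> a R\<close>; that is, the
  localizations of \<open>R\<close> at primes are valuation rings.

  If \<open>I\<close> is idempotent, then so is each localization \<open>I\<^sub>M\<close> at a maximal ideal \<open>M \<supseteq> I\<close>, and proper
  idempotent ideals of valuation rings are prime; the contractions \<open>P\<^sub>M\<close> of the \<open>I\<^sub>M\<close> are idempotent
  primes with intersection \<open>I\<close>. By finite character there are finitely many, and \<open>I = I\<^sup>n\<close> lies in
  the product of the minimal ones, which lies in their intersection \<open>I\<close>.

  A nonmaximal prime \<open>P \<noteq> 0\<close> is divisorial: for \<open>a \<notin> P\<close> finite character gives a finitely generated,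
  hence divisorial, ideal between \<open>P\<close> and \<open>P + aR\<close>. Let \<open>x \<notin> P\<close> lie in the divisorial closure
  of \<open>P\<close>, and let \<open>m \<in> M - P\<close> for a maximal \<open>M \<supseteq> P\<close>; with \<open>a = xm\<close>, the relation
  \<open>x \<in> P + xmR\<close> puts \<open>1 - dm\<close> into \<open>P\<close> for some \<open>d\<close>, so \<open>1 \<in> M\<close>.

  An idempotent maximal ideal \<open>M\<close> satisfies \<open>(R : M) = R\<close>, so it can be dropped from a product
  without changing the divisorial closure, and cannot occur in an incomparable representation of a
  divisorial ideal.
\<close>

subsection \<open>Ideals of commutative rings\<close>

lemma (in cring) cring_idealI:
  assumes "I \<subseteq> carrier R" "\<zero> \<in> I"
    and add: "\<And>x y. \<lbrakk>x \<in> I; y \<in> I\<rbrakk> \<Longrightarrow> x \<oplus> y \<in> I"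
    and mult: "\<And>x r. \<lbrakk>x \<in> I; r \<in> carrier R\<rbrakk> \<Longrightarrow> r \<otimes> x \<in> I"
  shows "ideal I R"
proof (rule idealI[OF ring_axioms])
  show "subgroup I (add_monoid R)"
  proof (rule add.subgroupI)
    fix x assume x: "x \<in> I"
    have "\<ominus> x = (\<ominus> \<one>) \<otimes> x" using x assms(1) by (auto simp: l_minus)
    thus "\<ominus> x \<in> I" using mult[OF x, of "\<ominus> \<one>"] by simp
  qed (use assms in auto)
next
  fix a x assume "a \<in> I" "x \<in> carrier R"
  thus "x \<otimes> a \<in> I" "a \<otimes> x \<in> I"
    using mult[of a x] m_comm[of a x] assms(1) by auto
qed

lemma (in ring) ideal_zero: "ideal I R \<Longrightarrow> \<zero> \<in> I"
  by (simp add: additive_subgroup.zero_closed ideal.axioms(1))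

lemma (in ring) ideal_add: "\<lbrakk>ideal I R; x \<in> I; y \<in> I\<rbrakk> \<Longrightarrow> x \<oplus> y \<in> I"
  by (simp add: additive_subgroup.a_closed ideal.axioms(1))

text \<open>Zorn's lemma for the ideals above \<open>I\<close> that omit \<open>\<one>\<close>: in
  this form properness visibly passes to unions of chains.\<close>

lemma (in cring) exists_maximalideal:
  assumes "ideal I R" "I \<noteq> carrier R"
  shows "\<exists>M. maximalideal M R \<and> I \<subseteq> M"
proof -
  define S where "S = {J. ideal J R \<and> I \<subseteq> J \<and> \<one> \<notin> J}"
  have one: "\<one> \<notin> J \<longleftrightarrow> J \<noteq> carrier R" if "ideal J R" for J
    using that ideal.one_imp_carrier one_closed by metis
  have "\<exists>M\<in>S. \<forall>J\<in>S. M \<subseteq> J \<longrightarrow> J = M"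
  proof (rule subset_Zorn)
    fix C assume C: "subset.chain S C"
    show "\<exists>U\<in>S. \<forall>J\<in>C. J \<subseteq> U"
    \<comment> \<open>The union of the empty chain is not an ideal; there \<open>I\<close> itself is
      the bound.\<close>
    proof (cases "C = {}")
      case True
      have "I \<in> S" using assms one by (auto simp: S_def)
      thus ?thesis using True by auto
    next
      case False
      have sub: "C \<subseteq> S" using C by (auto simp: pred_on.chain_def)
      have "subset.chain {J. ideal J R} C"
        using C by (auto simp: pred_on.chain_def S_def)
      hence "ideal (\<Union>C) R" using False chain_Union_is_ideal[of C] by simp
      hence "\<Union>C \<in> S" using sub False by (auto simp: S_def)
      thus ?thesis by blast
    qed
  qed
  then obtain M where M: "M \<in> S" and max: "\<And>J. \<lbrakk>J \<in> S; M \<subseteq> J\<rbrakk> \<Longrightarrow> J = M" by blast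
  have "maximalideal M R"
  proof (rule maximalidealI)
    fix J assume J: "ideal J R" "M \<subseteq> J" "J \<subseteq> carrier R"
    show "J = M \<or> J = carrier R"
    proof (cases "\<one> \<in> J")
      case False
      hence "J \<in> S" using J M by (auto simp: S_def)
      thus ?thesis using max J(2) by blast
    qed (use one[OF J(1)] in blast)
  qed (use M one in \<open>auto simp: S_def\<close>)
  thus ?thesis using M by (auto simp: S_def)
qed

lemma (in ring) ideal_prod_subset:
  assumes "ideal A R" "\<And>i j. \<lbrakk>i \<in> I; j \<in> J\<rbrakk> \<Longrightarrow> i \<otimes> j \<in> A"
  shows "ideal_prod R I J \<subseteq> A"
proof
  fix x assume "x \<in> ideal_prod R I J"
  thus "x \<in> A" by induct (use assms ideal_add in auto)
qed

lemma ideal_prod_mono: "\<lbrakk>I \<subseteq> I'; J \<subseteq> J'\<rbrakk> \<Longrightarrow> ideal_prod R I J \<subseteq> ideal_prod R I' J'"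
proof
  fix x assume "I \<subseteq> I'" "J \<subseteq> J'" "x \<in> ideal_prod R I J"
  from this(3,1,2) show "x \<in> ideal_prod R I' J'"
    by induct (auto intro: ideal_prod.intros)
qed

text \<open>For \<open>J = carrier R\<close> this is the principal ideal \<open>s R\<close>, the
  form in which divisibility appears below.\<close>

lemma (in cring) ideal_mult_image:
  assumes "ideal J R" "s \<in> carrier R"
  shows "ideal ((\<otimes>) s ` J) R"
proof (rule cring_idealI)
  have car: "J \<subseteq> carrier R" using assms(1) ideal.Icarr by fast
  show "(\<otimes>) s ` J \<subseteq> carrier R" using car assms(2) by auto
  show "\<zero> \<in> (\<otimes>) s ` J"
    using ideal_zero[OF assms(1)] assms(2) by (metis image_eqI r_null)
  fix x assume "x \<in> (\<otimes>) s ` J"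
  then obtain j where j: "j \<in> J" "x = s \<otimes> j" by blast
  {
    fix y assume "y \<in> (\<otimes>) s ` J"
    then obtain k where k: "k \<in> J" "y = s \<otimes> k" by blast
    have "x \<oplus> y = s \<otimes> (j \<oplus> k)" using j k car assms(2) by (simp add: r_distr subset_iff)
    thus "x \<oplus> y \<in> (\<otimes>) s ` J" using ideal_add[OF assms(1) j(1) k(1)] by blast
  next
    fix r assume r: "r \<in> carrier R"
    have "r \<otimes> x = s \<otimes> (r \<otimes> j)" using j r car assms(2) m_lcomm by auto
    thus "r \<otimes> x \<in> (\<otimes>) s ` J" using ideal.I_l_closed[OF assms(1) j(1) r] by blast
  }
qed

text \<open>This is the quotient \<open>(J : a)\<close>. It turns a claim about
  \<open>w \<otimes> a\<close> for all \<open>w\<close> in a product of ideals into a containment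
  that is checked on generators.\<close>

lemma (in cring) ideal_quotient_element:
  assumes "ideal J R" "a \<in> carrier R"
  shows "ideal {y \<in> carrier R. y \<otimes> a \<in> J} R"
  by (rule cring_idealI)
    (use assms ideal_zero ideal_add ideal.I_l_closed in \<open>auto simp: l_distr m_assoc\<close>)

section \<open>Contractions of localizations at primes\<close>

text \<open>The contraction to \<open>R\<close> of the localization \<open>I\<^sub>M\<close>.\<close>

definition (in cring) loc_contraction :: "'a set \<Rightarrow> 'a set \<Rightarrow> 'a set" where
  "loc_contraction M I = {x \<in> carrier R. \<exists>s \<in> carrier R - M. s \<otimes> x \<in> I}"

lemma (in cring) loc_contractionI:
  "\<lbrakk>x \<in> carrier R; s \<in> carrier R; s \<notin> M; s \<otimes> x \<in> I\<rbrakk> \<Longrightarrow> x \<in> loc_contraction M I"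
  by (auto simp: loc_contraction_def)

lemma (in cring) loc_contractionE:
  assumes "x \<in> loc_contraction M I"
  obtains s where "x \<in> carrier R" "s \<in> carrier R" "s \<notin> M" "s \<otimes> x \<in> I"
  using assms by (auto simp: loc_contraction_def)

lemma (in cring) prime_mult_notin:
  "\<lbrakk>primeideal M R; s \<in> carrier R; s \<notin> M; t \<in> carrier R; t \<notin> M\<rbrakk> \<Longrightarrow> s \<otimes> t \<notin> M"
  using primeideal.I_prime by fast

lemma (in cring) prime_one_notin: "primeideal M R \<Longrightarrow> \<one> \<notin> M"
  using ideal.one_imp_carrier primeideal.I_notcarr primeideal.axioms(1) by fast

lemma (in cring) ideal_loc_contraction:
  assumes "primeideal M R" "ideal I R"
  shows "ideal (loc_contraction M I) R"
proof (rule cring_idealI)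
  show "loc_contraction M I \<subseteq> carrier R" by (auto simp: loc_contraction_def)
  show "\<zero> \<in> loc_contraction M I"
    using prime_one_notin[OF assms(1)] ideal_zero[OF assms(2)]
    by (auto intro!: loc_contractionI[of _ \<one>])
  fix x assume "x \<in> loc_contraction M I"
  then obtain s where s: "x \<in> carrier R" "s \<in> carrier R" "s \<notin> M" "s \<otimes> x \<in> I"
    by (rule loc_contractionE)
  {
    fix y assume "y \<in> loc_contraction M I"
    then obtain t where t: "y \<in> carrier R" "t \<in> carrier R" "t \<notin> M" "t \<otimes> y \<in> I"
      by (rule loc_contractionE)
    have "(s \<otimes> t) \<otimes> (x \<oplus> y) = t \<otimes> (s \<otimes> x) \<oplus> s \<otimes> (t \<otimes> y)"
      using s t by algebra
    moreover have "\<dots> \<in> I"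
      using s t ideal_add[OF assms(2)] ideal.I_l_closed[OF assms(2)] by blast
    ultimately show "x \<oplus> y \<in> loc_contraction M I"
      using s t prime_mult_notin[OF assms(1)] by (intro loc_contractionI[of _ "s \<otimes> t"]) auto
  next
    fix r assume r: "r \<in> carrier R"
    have "s \<otimes> (r \<otimes> x) = r \<otimes> (s \<otimes> x)" using s r by algebra
    hence "s \<otimes> (r \<otimes> x) \<in> I" using s r ideal.I_l_closed[OF assms(2)] by metis
    thus "r \<otimes> x \<in> loc_contraction M I" using s r by (intro loc_contractionI[of _ s]) auto
  }
qed

lemma (in cring) loc_contraction_superset:
  assumes "primeideal M R" "ideal I R"
  shows "I \<subseteq> loc_contraction M I"
proof
  fix x assume x: "x \<in> I"
  have "x \<in> carrier R" using x ideal.Icarr[OF assms(2)] by blast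
  thus "x \<in> loc_contraction M I"
    using x prime_one_notin[OF assms(1)] by (intro loc_contractionI[of x \<one>]) auto
qed

lemma (in cring) loc_contraction_mono: "I \<subseteq> J \<Longrightarrow> loc_contraction M I \<subseteq> loc_contraction M J"
  by (auto simp: loc_contraction_def)

lemma (in cring) loc_contraction_idem:
  "primeideal M R \<Longrightarrow> loc_contraction M (loc_contraction M I) \<subseteq> loc_contraction M I"
proof
  fix x assume M: "primeideal M R" and "x \<in> loc_contraction M (loc_contraction M I)"
  then obtain s where s: "x \<in> carrier R" "s \<in> carrier R" "s \<notin> M" "s \<otimes> x \<in> loc_contraction M I"
    by (auto elim: loc_contractionE)
  then obtain t where t: "t \<in> carrier R" "t \<notin> M" "t \<otimes> (s \<otimes> x) \<in> I"
    by (auto elim: loc_contractionE)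
  thus "x \<in> loc_contraction M I"
    using s prime_mult_notin[OF M] by (intro loc_contractionI[of x "t \<otimes> s"]) (auto simp: m_assoc)
qed

lemma (in cring) loc_contraction_subset:
  assumes "primeideal M R" "I \<subseteq> M"
  shows "loc_contraction M I \<subseteq> M"
  using primeideal.I_prime[OF assms(1)] assms(2) by (auto simp: loc_contraction_def)

text \<open>If \<open>x \<notin> I\<close>, then \<open>(I : x)\<close> is proper and lies in a
  maximal \<open>M\<close>; but membership locally at \<open>M\<close> provides an element of
  \<open>(I : x)\<close> outside \<open>M\<close>.\<close>

lemma (in cring) mem_ideal_if_locally:
  assumes I: "ideal I R" and x: "x \<in> carrier R"
    and loc: "\<And>M. \<lbrakk>maximalideal M R; I \<subseteq> M\<rbrakk> \<Longrightarrow> x \<in> loc_contraction M I"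
  shows "x \<in> I"
proof (rule ccontr)
  assume "x \<notin> I"
  let ?Q = "{y \<in> carrier R. y \<otimes> x \<in> I}"
  have "\<one> \<notin> ?Q" using \<open>x \<notin> I\<close> x by simp
  hence "?Q \<noteq> carrier R" using one_closed by blast
  then obtain M where M: "maximalideal M R" "?Q \<subseteq> M"
    using exists_maximalideal[OF ideal_quotient_element[OF I x]] by blast
  \<comment> \<open>This puts \<open>I\<close> inside \<open>M\<close>, so only the maximal ideals
    above \<open>I\<close>, those that finite character controls, have to be tested.\<close>
  have "I \<subseteq> ?Q" using I x ideal.Icarr ideal.I_r_closed by fast
  hence "x \<in> loc_contraction M I" using loc M by blast
  thus False using M(2) by (auto elim: loc_contractionE)
qed

subsection \<open>Localization in arithmetical domains\<close>

text \<open>The condition expresses, without reference to the quotient field, that any two principal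
  ideals become comparable in each localization at a prime.\<close>

locale arithmetical_domain = "domain" +
  assumes compare: "\<lbrakk>a \<in> carrier R; b \<in> carrier R\<rbrakk> \<Longrightarrow>
    \<exists>e \<in> carrier R. \<exists>f \<in> carrier R. \<exists>g \<in> carrier R.
      e \<otimes> a = b \<otimes> f \<and> (\<one> \<ominus> e) \<otimes> b = a \<otimes> g"
begin

text \<open>Since \<open>e\<close> and \<open>\<one> \<ominus> e\<close> sum to
  \<open>\<one>\<close>, one of them lies outside \<open>M\<close> and is a unit in the
  localization; its equation is the required divisibility.\<close>

lemma local_chain:
  assumes "primeideal M R" "a \<in> carrier R" "b \<in> carrier R"
  shows "a \<in> loc_contraction M ((\<otimes>) b ` carrier R) \<or> b \<in> loc_contraction M ((\<otimes>) a ` carrier R)"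
proof -
  obtain e f g where e: "e \<in> carrier R" "f \<in> carrier R" "g \<in> carrier R"
    "e \<otimes> a = b \<otimes> f" "(\<one> \<ominus> e) \<otimes> b = a \<otimes> g"
    using compare[OF assms(2,3)] by blast
  have M: "ideal M R" by (rule primeideal.axioms(1)[OF assms(1)])
  have "e \<oplus> (\<one> \<ominus> e) = \<one>" using e(1) by algebra
  hence "e \<notin> M \<or> \<one> \<ominus> e \<notin> M"
    using ideal_add[OF M] prime_one_notin[OF assms(1)] by metis
  thus ?thesis
  proof
    assume "e \<notin> M"
    hence "a \<in> loc_contraction M ((\<otimes>) b ` carrier R)"
      using e assms(2) by (intro loc_contractionI[of a e]) auto
    thus ?thesis ..
  next
    assume "\<one> \<ominus> e \<notin> M"
    hence "b \<in> loc_contraction M ((\<otimes>) a ` carrier R)"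
      using e assms(3) by (intro loc_contractionI[of b "\<one> \<ominus> e"]) auto
    thus ?thesis ..
  qed
qed

lemma mult_carrier_subset: "\<lbrakk>ideal I R; i \<in> I\<rbrakk> \<Longrightarrow> (\<otimes>) i ` carrier R \<subseteq> I"
  using ideal.I_r_closed by fast

text \<open>
  If \<open>x\<^sup>2 \<in> I\<^sub>M\<close> but \<open>x \<notin> I\<^sub>M\<close>, then \<open>I\<^sub>M \<subseteq> x R\<^sub>M\<close>, hence
  \<open>x\<^sup>2 \<in> I\<^sub>M = I\<^sub>M\<^sup>3 \<subseteq> x\<^sup>2 I\<^sub>M\<close>, and cancelling \<open>x\<^sup>2\<close> yields \<open>1 \<in> I\<^sub>M\<close>.
\<close>

lemma square_mem_loc_contraction:
  assumes M: "primeideal M R" and I: "idempotent_ideal R I" "I \<subseteq> M"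
    and x: "x \<in> carrier R" "x \<otimes> x \<in> loc_contraction M I"
  shows "x \<in> loc_contraction M I"
proof (rule ccontr)
  assume notin: "x \<notin> loc_contraction M I"
  have idI: "ideal I R" and II: "ideal_prod R I I = I" using I by (auto simp: idempotent_ideal_def)
  have x0: "x \<noteq> \<zero>" using notin ideal_zero[OF ideal_loc_contraction[OF M idI]] by blast
  \<comment> \<open>The contraction of \<open>x\<^sup>2 I\<^sub>M\<close>, which is to contain all
    of \<open>I\<close>.\<close>
  define A where "A = loc_contraction M ((\<otimes>) (x \<otimes> x) ` I)"
  have A: "ideal A R"
    using ideal_loc_contraction[OF M] ideal_mult_image[OF idI] x(1) by (simp add: A_def)
  have fact: "\<exists>e f. e \<in> carrier R \<and> e \<notin> M \<and> f \<in> carrier R \<and> e \<otimes> i = x \<otimes> f" if i: "i \<in> I" for i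
  proof -
    have "x \<notin> loc_contraction M ((\<otimes>) i ` carrier R)"
      using notin loc_contraction_mono[OF mult_carrier_subset[OF idI i]] by blast
    hence "i \<in> loc_contraction M ((\<otimes>) x ` carrier R)"
      using local_chain[OF M x(1)] ideal.Icarr[OF idI i] by blast
    thus ?thesis by (auto elim!: loc_contractionE)
  qed
  have "i \<otimes> w \<in> A" if i: "i \<in> I" and w: "w \<in> ideal_prod R I I" for i w
  proof -
    have ic: "i \<in> carrier R" using ideal.Icarr[OF idI i] .
    \<comment> \<open>With \<open>i\<close> fixed, the claim is a containment in
      \<open>(A : i)\<close>, so \<open>w = j \<otimes> k\<close> suffices. Locally \<open>i\<close>
      and \<open>j\<close> each give one factor \<open>x\<close>, while \<open>k\<close> keeps the
      cofactor in \<open>I\<close>.\<close>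
    have "ideal_prod R I I \<subseteq> {y \<in> carrier R. y \<otimes> i \<in> A}"
    proof (rule ideal_prod_subset[OF ideal_quotient_element[OF A ic]])
      fix j k assume jk: "j \<in> I" "k \<in> I"
      have c: "j \<in> carrier R" "k \<in> carrier R" using jk ideal.Icarr[OF idI] by auto
      obtain e f where e: "e \<in> carrier R" "e \<notin> M" "f \<in> carrier R" "e \<otimes> i = x \<otimes> f"
        using fact[OF i] by blast
      obtain e' f' where e': "e' \<in> carrier R" "e' \<notin> M" "f' \<in> carrier R" "e' \<otimes> j = x \<otimes> f'"
        using fact[OF jk(1)] by blast
      have "(e \<otimes> e') \<otimes> ((j \<otimes> k) \<otimes> i) = (e \<otimes> i) \<otimes> (e' \<otimes> j) \<otimes> k"
        using e(1) e'(1) c ic by algebra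
      also have "\<dots> = (x \<otimes> f) \<otimes> (x \<otimes> f') \<otimes> k" by (simp only: e(4) e'(4))
      also have "\<dots> = (x \<otimes> x) \<otimes> ((f \<otimes> f') \<otimes> k)"
        using e(3) e'(3) c x(1) by algebra
      finally have eq: "(e \<otimes> e') \<otimes> ((j \<otimes> k) \<otimes> i) = (x \<otimes> x) \<otimes> ((f \<otimes> f') \<otimes> k)" .
      have "(f \<otimes> f') \<otimes> k \<in> I" using ideal.I_l_closed[OF idI jk(2)] e(3) e'(3) by simp
      hence "(e \<otimes> e') \<otimes> ((j \<otimes> k) \<otimes> i) \<in> (\<otimes>) (x \<otimes> x) ` I" using eq by blast
      hence "(j \<otimes> k) \<otimes> i \<in> A"
        unfolding A_def using c ic e(1,2) e'(1,2) prime_mult_notin[OF M]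
        by (intro loc_contractionI[of _ "e \<otimes> e'"]) auto
      thus "j \<otimes> k \<in> {y \<in> carrier R. y \<otimes> i \<in> A}" using c by simp
    qed
    hence "w \<in> carrier R" "w \<otimes> i \<in> A" using w by auto
    thus ?thesis using ic m_comm by simp
  qed
  hence "ideal_prod R I (ideal_prod R I I) \<subseteq> A" by (rule ideal_prod_subset[OF A])
  hence "I \<subseteq> A" by (simp add: II)
  hence "x \<otimes> x \<in> A"
    using x(2) loc_contraction_mono loc_contraction_idem[OF M] unfolding A_def by blast
  then obtain s j where s: "s \<in> carrier R" "s \<notin> M" "j \<in> I" "s \<otimes> (x \<otimes> x) = (x \<otimes> x) \<otimes> j"
    by (auto simp: A_def elim!: loc_contractionE)
  \<comment> \<open>Cancelling puts \<open>s\<close>, which is outside \<open>M\<close>, into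
    \<open>I \<subseteq> M\<close>.\<close>
  have "(x \<otimes> x) \<otimes> s = (x \<otimes> x) \<otimes> j" using s(1,4) x(1) m_comm by simp
  hence "s = j"
    using x0 x(1) s(1) ideal.Icarr[OF idI s(3)] by (simp add: m_lcancel integral_iff)
  thus False using s I(2) by blast
qed

text \<open>If \<open>x y\<close> lies in the contraction, one factor is locally a multiple of the
  other, say \<open>x\<close> of \<open>y\<close>. Then \<open>x\<^sup>2\<close> is locally a
  multiple of \<open>x y\<close>, and \<open>square_mem_loc_contraction\<close> gives
  \<open>x\<close>.\<close>

lemma primeideal_loc_contraction:
  assumes M: "primeideal M R" and I: "idempotent_ideal R I" "I \<subseteq> M"
  shows "primeideal (loc_contraction M I) R"
proof -
  let ?P = "loc_contraction M I"
  have idI: "ideal I R" using I by (auto simp: idempotent_ideal_def)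
  have P: "ideal ?P R" by (rule ideal_loc_contraction[OF M idI])
  have key: "x \<in> ?P"
    if xy: "x \<in> carrier R" "y \<in> carrier R" "x \<otimes> y \<in> ?P" "x \<in> loc_contraction M ((\<otimes>) y ` carrier R)"
    for x y
  proof -
    obtain e f where e: "e \<in> carrier R" "e \<notin> M" "f \<in> carrier R" "e \<otimes> x = y \<otimes> f"
      using xy(4) by (auto elim!: loc_contractionE)
    have "e \<otimes> (x \<otimes> x) = (e \<otimes> x) \<otimes> x" using e(1) xy(1) by algebra
    also have "\<dots> = f \<otimes> (x \<otimes> y)" unfolding e(4) using e(3) xy(1,2) by algebra
    finally have "e \<otimes> (x \<otimes> x) \<in> ?P" using ideal.I_l_closed[OF P xy(3) e(3)] by simp
    hence "x \<otimes> x \<in> loc_contraction M ?P"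
      using e(1,2) xy(1) by (simp add: loc_contractionI[of "x \<otimes> x" e])
    thus ?thesis using square_mem_loc_contraction[OF M I xy(1)] loc_contraction_idem[OF M] by blast
  qed
  show ?thesis
  proof (rule primeidealI[OF P is_cring])
    show "carrier R \<noteq> ?P"
      using loc_contraction_subset[OF M I(2)] prime_one_notin[OF M] one_closed by blast
    fix x y assume xy: "x \<in> carrier R" "y \<in> carrier R" "x \<otimes> y \<in> ?P"
    thus "x \<in> ?P \<or> y \<in> ?P"
      using local_chain[OF M xy(1,2)] key[of x y] key[of y x] m_comm[of x y] by auto
  qed
qed

text \<open>Locally at a maximal ideal above \<open>P\<close>, \<open>s\<close> divides each element
  of \<open>P\<close> with cofactor again in \<open>P\<close>; hence
  \<open>P\<^sup>2 \<subseteq> s P\<^sup>2\<close> there, and \<open>s\<close> cancels. In other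
  words, \<open>P\<^sup>2\<close> is \<open>P\<close>-primary.\<close>

lemma mem_prime_square_if_mult_mem:
  assumes P: "primeideal P R" and s: "s \<in> carrier R" "s \<notin> P"
    and x: "x \<in> carrier R" "s \<otimes> x \<in> ideal_prod R P P"
  shows "x \<in> ideal_prod R P P"
proof (rule mem_ideal_if_locally)
  have idP: "ideal P R" by (rule primeideal.axioms(1)[OF P])
  show PP: "ideal (ideal_prod R P P) R" by (rule ideal_prod_is_ideal[OF idP idP])
  show "x \<in> carrier R" by fact
  fix N assume "maximalideal N R" and sub: "ideal_prod R P P \<subseteq> N"
  hence N: "primeideal N R" by (simp add: maximalideal_prime)
  have PN: "P \<subseteq> N" using primeideal_divides_ideal_prod[OF N idP idP sub] by blast
  let ?A = "loc_contraction N ((\<otimes>) s ` ideal_prod R P P)"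
  have A: "ideal ?A R" by (rule ideal_loc_contraction[OF N ideal_mult_image[OF PP s(1)]])
  have "ideal_prod R P P \<subseteq> ?A"
  proof (rule ideal_prod_subset[OF A])
    fix p q assume pq: "p \<in> P" "q \<in> P"
    have c: "p \<in> carrier R" "q \<in> carrier R" using pq ideal.Icarr[OF idP] by auto
    \<comment> \<open>Otherwise \<open>e \<otimes> s \<in> P\<close> with \<open>e\<close> and
      \<open>s\<close> both outside \<open>P\<close>. So \<open>p\<close> is locally a multiple of
      \<open>s\<close>.\<close>
    have "s \<notin> loc_contraction N ((\<otimes>) p ` carrier R)"
    proof
      assume "s \<in> loc_contraction N ((\<otimes>) p ` carrier R)"
      then obtain e f where "e \<in> carrier R" "e \<notin> N" "f \<in> carrier R" "e \<otimes> s = p \<otimes> f"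
        by (auto elim!: loc_contractionE)
      thus False using PN ideal.I_r_closed[OF idP pq(1), of f] primeideal.I_prime[OF P, of e s] s by auto
    qed
    hence "p \<in> loc_contraction N ((\<otimes>) s ` carrier R)" using local_chain[OF N c(1) s(1)] by blast
    then obtain e f where e: "e \<in> carrier R" "e \<notin> N" "f \<in> carrier R" "e \<otimes> p = s \<otimes> f"
      by (auto elim!: loc_contractionE)
    have "s \<otimes> f \<in> P" using ideal.I_l_closed[OF idP pq(1) e(1)] e(4) by simp
    hence f: "f \<in> P" using primeideal.I_prime[OF P s(1) e(3)] s(2) by blast
    have "e \<otimes> (p \<otimes> q) = s \<otimes> (f \<otimes> q)" using e c s(1) by (metis m_assoc)
    hence "e \<otimes> (p \<otimes> q) \<in> (\<otimes>) s ` ideal_prod R P P"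
      using ideal_prod.prod[OF f pq(2), of R] by blast
    thus "p \<otimes> q \<in> ?A" using e c by (intro loc_contractionI[of _ e]) auto
  qed
  hence "s \<otimes> x \<in> ?A" using x(2) by blast
  then obtain e z where e: "e \<in> carrier R" "e \<notin> N" "z \<in> ideal_prod R P P"
      "e \<otimes> (s \<otimes> x) = s \<otimes> z"
    by (auto elim!: loc_contractionE)
  have s0: "s \<noteq> \<zero>" using s(2) ideal_zero[OF idP] by blast
  have zc: "z \<in> carrier R" using ideal.Icarr[OF PP e(3)] .
  have "s \<otimes> (e \<otimes> x) = e \<otimes> (s \<otimes> x)" using s(1) e(1) x(1) by algebra
  hence "e \<otimes> x = z" using e(1,4) s(1) x(1) s0 zc by (simp add: m_lcancel)
  thus "x \<in> loc_contraction N (ideal_prod R P P)"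
    using e x(1) by (intro loc_contractionI[of x e]) auto
qed

text \<open>For \<open>x\<close> in the contraction \<open>P\<close> there is \<open>s\<close>
  outside \<open>M\<close>, hence outside \<open>P\<close>, with
  \<open>s x \<in> I = I\<^sup>2 \<subseteq> P\<^sup>2\<close>; as \<open>P\<^sup>2\<close> is
  primary, \<open>s\<close> can be removed.\<close>

lemma idempotent_loc_contraction:
  assumes M: "primeideal M R" and I: "idempotent_ideal R I" "I \<subseteq> M"
  shows "idempotent_ideal R (loc_contraction M I)"
proof -
  let ?P = "loc_contraction M I"
  have idI: "ideal I R" and II: "ideal_prod R I I = I" using I by (auto simp: idempotent_ideal_def)
  have P: "primeideal ?P R" by (rule primeideal_loc_contraction[OF M I])
  have idP: "ideal ?P R" by (rule primeideal.axioms(1)[OF P])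
  have "?P \<subseteq> ideal_prod R ?P ?P"
  proof
    fix x assume "x \<in> ?P"
    then obtain s where s: "x \<in> carrier R" "s \<in> carrier R" "s \<notin> M" "s \<otimes> x \<in> I"
      by (rule loc_contractionE)
    have IP: "I \<subseteq> ?P" by (rule loc_contraction_superset[OF M idI])
    have "s \<otimes> x \<in> ideal_prod R ?P ?P" using s(4) ideal_prod_mono[OF IP IP, of R] II by auto
    moreover have "s \<notin> ?P" using loc_contraction_subset[OF M I(2)] s(3) by blast
    ultimately show "x \<in> ideal_prod R ?P ?P" using mem_prime_square_if_mult_mem[OF P] s by blast
  qed
  thus ?thesis using idP ideal_prod_inter[OF idP idP] by (auto simp: idempotent_ideal_def)
qed

end

subsection \<open>Finite products of ideals\<close>

lemma ideal_prod_list_simps [simp]: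
  "ideal_prod_list R [] = carrier R"
  "ideal_prod_list R (P # Ps) = ideal_prod R P (ideal_prod_list R Ps)"
  by (simp_all add: ideal_prod_list_def)

lemma (in ring) ideal_ideal_prod_list:
  "(\<And>P. P \<in> set Ps \<Longrightarrow> ideal P R) \<Longrightarrow> ideal (ideal_prod_list R Ps) R"
  by (induct Ps) (simp_all add: oneideal ideal_prod_is_ideal)

lemma (in ring) ideal_prod_list_subset:
  "\<lbrakk>\<And>P. P \<in> set Ps \<Longrightarrow> ideal P R; Q \<in> set Ps\<rbrakk> \<Longrightarrow> ideal_prod_list R Ps \<subseteq> Q"
proof (induct Ps)
  case (Cons P Ps)
  have "ideal_prod R P (ideal_prod_list R Ps) \<subseteq> P \<inter> ideal_prod_list R Ps"
    using Cons.prems(1) by (intro ideal_prod_inter ideal_ideal_prod_list) auto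
  thus ?case using Cons by auto
qed simp

lemma (in ring) idempotent_subset_ideal_prod_list:
  assumes "idempotent_ideal R I" "\<And>P. P \<in> set Ps \<Longrightarrow> I \<subseteq> P"
  shows "I \<subseteq> ideal_prod_list R Ps"
  using assms(2)
proof (induct Ps)
  case Nil
  show ?case using assms(1) ideal.Icarr by (auto simp: idempotent_ideal_def)
next
  case (Cons P Ps)
  hence "ideal_prod R I I \<subseteq> ideal_prod R P (ideal_prod_list R Ps)"
    by (intro ideal_prod_mono) auto
  thus ?case using assms(1) by (simp add: idempotent_ideal_def)
qed

lemma (in cring) idempotent_ideal_prod:
  assumes "idempotent_ideal R I" "idempotent_ideal R J"
  shows "idempotent_ideal R (ideal_prod R I J)"
proof -
  have I: "ideal I R" "ideal_prod R I I = I" and J: "ideal J R" "ideal_prod R J J = J"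
    using assms by (auto simp: idempotent_ideal_def)
  note ids = I(1) J(1) ideal_prod_is_ideal
  have "ideal_prod R (ideal_prod R I J) (ideal_prod R I J)
      = ideal_prod R I (ideal_prod R (ideal_prod R J I) J)"
    by (simp add: ids ideal_prod_assoc)
  also have "\<dots> = ideal_prod R I (ideal_prod R (ideal_prod R I J) J)"
    by (simp add: ideal_prod_commute[OF J(1) I(1)])
  also have "\<dots> = ideal_prod R (ideal_prod R I I) (ideal_prod R J J)"
    by (simp add: ids ideal_prod_assoc)
  finally show ?thesis by (simp add: I J ideal_prod_is_ideal idempotent_ideal_def)
qed

lemma (in cring) idempotent_ideal_prod_list:
  "(\<And>P. P \<in> set Ps \<Longrightarrow> idempotent_ideal R P) \<Longrightarrow> idempotent_ideal R (ideal_prod_list R Ps)"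
proof (induct Ps)
  case Nil
  show ?case by (simp add: idempotent_ideal_def oneideal ideal_prod_one)
qed (simp add: idempotent_ideal_prod)

lemma (in cring) prime_divides_ideal_prod_list:
  assumes "primeideal Q R"
  shows "\<lbrakk>\<And>P. P \<in> set Ps \<Longrightarrow> ideal P R; ideal_prod_list R Ps \<subseteq> Q\<rbrakk> \<Longrightarrow> \<exists>P \<in> set Ps. P \<subseteq> Q"
proof (induct Ps)
  case Nil
  thus ?case using prime_one_notin[OF assms] by auto
next
  case (Cons P Ps)
  have "P \<subseteq> Q \<or> ideal_prod_list R Ps \<subseteq> Q"
    using Cons.prems by (intro primeideal_divides_ideal_prod[OF assms] ideal_ideal_prod_list) auto
  thus ?case using Cons by auto
qed

text \<open>The list enumerates the inclusion-minimal members of \<open>F\<close>. Every member lies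
  above a minimal one, so the product is contained in the intersection; the converse uses that
  \<open>I\<close> equals its powers. Intersecting with \<open>carrier R\<close> gives the right
  value for empty \<open>F\<close>.\<close>

lemma (in ring) incomparable_ideal_prod_list_of_Inter:
  assumes I: "idempotent_ideal R I" "I = carrier R \<inter> \<Inter>F"
    and F: "finite F" "\<And>P. P \<in> F \<Longrightarrow> ideal P R"
  shows "\<exists>Ps. set Ps \<subseteq> F \<and> incomparable Ps \<and> I = ideal_prod_list R Ps"
proof -
  let ?S = "{P \<in> F. \<forall>Q \<in> F. Q \<subseteq> P \<longrightarrow> P = Q}"
  have "finite ?S" using F(1) by simp
  from finite_distinct_list[OF this] obtain Ps where Ps: "set Ps = ?S" "distinct Ps" by blast
  have "incomparable Ps"
    unfolding incomparable_def
  proof (intro allI impI notI)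
    fix i j assume ij: "i < length Ps" "j < length Ps" "i \<noteq> j" "Ps ! i \<subseteq> Ps ! j"
    have "Ps ! i \<in> ?S" "Ps ! j \<in> ?S" using ij(1,2) Ps(1) nth_mem by blast+
    hence "Ps ! i = Ps ! j" using ij(4) by blast
    thus False using ij Ps(2) by (simp add: nth_eq_iff_index_eq)
  qed
  moreover have "I = ideal_prod_list R Ps"
  proof
    show "I \<subseteq> ideal_prod_list R Ps"
      by (rule idempotent_subset_ideal_prod_list[OF I(1)]) (use I(2) Ps(1) in auto)
    have ids: "ideal P R" if "P \<in> set Ps" for P using that F(2) Ps(1) by blast
    have "ideal_prod_list R Ps \<subseteq> P" if P: "P \<in> F" for P
    proof -
      obtain Q where "Q \<in> F" "Q \<subseteq> P" "\<forall>b\<in>F. b \<subseteq> Q \<longrightarrow> Q = b"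
        using finite_has_minimal2[OF F(1) P] by blast
      hence "Q \<in> set Ps" "Q \<subseteq> P" using Ps(1) by auto
      thus ?thesis using ideal_prod_list_subset[OF ids] by blast
    qed
    moreover have "ideal_prod_list R Ps \<subseteq> carrier R"
      using ideal.Icarr[OF ideal_ideal_prod_list[OF ids]] by blast
    ultimately show "ideal_prod_list R Ps \<subseteq> I" unfolding I(2) by blast
  qed
  ultimately show ?thesis using Ps(1) by blast
qed

section \<open>Uniqueness of incomparable representations\<close>

lemma incomparable_distinct: "incomparable Ps \<Longrightarrow> distinct Ps"
  unfolding incomparable_def distinct_conv_nth by (metis order_refl)

lemma incomparable_eqI: "\<lbrakk>incomparable Ps; P \<in> set Ps; Q \<in> set Ps; P \<subseteq> Q\<rbrakk> \<Longrightarrow> P = Q"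
  unfolding incomparable_def by (metis in_set_conv_nth)

text \<open>Each factor \<open>P\<close> of one product contains a factor \<open>Q\<close> of the
  other, which contains a factor \<open>P'\<close> of the first. Incomparability forces
  \<open>P' = P\<close>, hence \<open>Q = P\<close>. So the lists have the same entries, and neither
  has repetitions.\<close>

lemma (in cring) incomparable_primes_unique:
  assumes Ps: "incomparable Ps" "\<And>P. P \<in> set Ps \<Longrightarrow> primeideal P R"
    and Qs: "incomparable Qs" "\<And>Q. Q \<in> set Qs \<Longrightarrow> primeideal Q R"
    and eq: "ideal_prod_list R Ps = ideal_prod_list R Qs"
  shows "mset Ps = mset Qs"
proof -
  have dominates: "\<exists>Q \<in> set Ys. Q \<subseteq> P"
    if P: "P \<in> set Xs" and X: "\<And>P. P \<in> set Xs \<Longrightarrow> primeideal P R"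
      and Y: "\<And>P. P \<in> set Ys \<Longrightarrow> primeideal P R"
      and XY: "ideal_prod_list R Xs = ideal_prod_list R Ys" for P Xs Ys
  proof (rule prime_divides_ideal_prod_list[OF X[OF P]])
    show "ideal Q R" if "Q \<in> set Ys" for Q by (rule primeideal.axioms(1)[OF Y[OF that]])
    show "ideal_prod_list R Ys \<subseteq> P"
      unfolding XY[symmetric]
      by (rule ideal_prod_list_subset[OF primeideal.axioms(1)[OF X] P])
  qed
  have "set Xs \<subseteq> set Ys"
    if X: "incomparable Xs" "\<And>P. P \<in> set Xs \<Longrightarrow> primeideal P R"
      and Y: "\<And>P. P \<in> set Ys \<Longrightarrow> primeideal P R"
      and XY: "ideal_prod_list R Xs = ideal_prod_list R Ys" for Xs Ys
  proof
    fix P assume P: "P \<in> set Xs"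
    obtain Q where Q: "Q \<in> set Ys" "Q \<subseteq> P" using dominates[OF P X(2) Y XY] by blast
    obtain P' where P': "P' \<in> set Xs" "P' \<subseteq> Q" using dominates[OF Q(1) Y X(2) XY[symmetric]] by blast
    have "P' = P" using incomparable_eqI[OF X(1) P'(1) P] P'(2) Q(2) by blast
    thus "P \<in> set Ys" using P'(2) Q by auto
  qed
  hence "set Ps = set Qs" using Ps Qs eq by (intro subset_antisym) auto
  thus ?thesis
    using incomparable_distinct[OF Ps(1)] incomparable_distinct[OF Qs(1)] set_eq_iff_mset_eq_distinct
    by blast
qed

subsection \<open>Idempotent and nonmaximal primes\<close>

context arithmetical_domain
begin

lemma idempotent_eq_Inter_primes:
  assumes I: "idempotent_ideal R I" and fin: "finite {M. maximalideal M R \<and> I \<subseteq> M}"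
  shows "\<exists>F. finite F \<and> (\<forall>P \<in> F. primeideal P R \<and> idempotent_ideal R P) \<and> I = carrier R \<inter> \<Inter>F"
proof -
  have idI: "ideal I R" using I by (simp add: idempotent_ideal_def)
  \<comment> \<open>For \<open>I = carrier R\<close> this family is empty.\<close>
  let ?F = "(\<lambda>M. loc_contraction M I) ` {M. maximalideal M R \<and> I \<subseteq> M}"
  have "carrier R \<inter> \<Inter>?F \<subseteq> I" using mem_ideal_if_locally[OF idI] by blast
  moreover have "I \<subseteq> carrier R" using ideal.Icarr[OF idI] by blast
  moreover have "I \<subseteq> \<Inter>?F" using loc_contraction_superset[OF _ idI] maximalideal_prime by blast
  ultimately have "I = carrier R \<inter> \<Inter>?F" by blast
  moreover have "primeideal P R \<and> idempotent_ideal R P" if "P \<in> ?F" for P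
    using that primeideal_loc_contraction idempotent_loc_contraction I maximalideal_prime by blast
  ultimately show ?thesis using fin by (intro exI[of _ ?F]) blast
qed

text \<open>The product is idempotent, so its contraction at a maximal ideal above it is prime and
  therefore contains one of the factors. Elements of the intersection thus lie locally in the
  product.\<close>

lemma ideal_prod_list_eq_Inter:
  assumes Ps: "\<And>P. P \<in> set Ps \<Longrightarrow> ideal P R \<and> idempotent_ideal R P"
  shows "ideal_prod_list R Ps = carrier R \<inter> \<Inter>(set Ps)"
proof
  let ?I = "ideal_prod_list R Ps"
  have ids: "\<And>P. P \<in> set Ps \<Longrightarrow> ideal P R" using Ps by blast
  have I: "idempotent_ideal R ?I" using Ps by (intro idempotent_ideal_prod_list) blast
  have idI: "ideal ?I R" by (rule ideal_ideal_prod_list[OF ids])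
  show "?I \<subseteq> carrier R \<inter> \<Inter>(set Ps)"
    using ideal_prod_list_subset[OF ids] ideal.Icarr[OF idI] by blast
  show "carrier R \<inter> \<Inter>(set Ps) \<subseteq> ?I"
  proof
    fix x assume x: "x \<in> carrier R \<inter> \<Inter>(set Ps)"
    show "x \<in> ?I"
    proof (rule mem_ideal_if_locally[OF idI])
      fix M assume "maximalideal M R" and sub: "?I \<subseteq> M"
      hence M: "primeideal M R" by (simp add: maximalideal_prime)
      have "\<exists>P \<in> set Ps. P \<subseteq> loc_contraction M ?I"
        by (rule prime_divides_ideal_prod_list[OF primeideal_loc_contraction[OF M I sub] ids
              loc_contraction_superset[OF M idI]])
      thus "x \<in> loc_contraction M ?I" using x by blast
    qed (use x in blast)
  qed
qed

text \<open>Besides \<open>a\<close>, finitely many elements of \<open>P\<close> are taken as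
  generators so that every maximal ideal above \<open>J\<close> contains \<open>P\<close>. At such
  an ideal \<open>a \<notin> P\<close> makes \<open>a\<close> a divisor of all of
  \<open>P\<close>.\<close>

lemma finitely_generated_between:
  assumes P: "primeideal P R" and a: "a \<in> carrier R" "a \<notin> P"
    and fin: "finite {N. maximalideal N R \<and> a \<in> N}"
  shows "\<exists>J. ideal J R \<and> finitely_generated_ideal R J \<and> a \<in> J \<and> P \<subseteq> J \<and> J \<subseteq> set_add R P (PIdl a)"
proof -
  have idP: "ideal P R" by (rule primeideal.axioms(1)[OF P])
  let ?N = "{N. maximalideal N R \<and> a \<in> N \<and> \<not> P \<subseteq> N}"
  have "finite ?N" by (rule finite_subset[OF _ fin]) blast
  \<comment> \<open>Each \<open>p N\<close> serves to rule out one maximal ideal that contains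
    \<open>a\<close> but not \<open>P\<close>.\<close>
  obtain p where p: "\<And>N. N \<in> ?N \<Longrightarrow> p N \<in> P \<and> p N \<notin> N"
    by atomize_elim (use bchoice[of ?N "\<lambda>N x. x \<in> P \<and> x \<notin> N"] in blast)
  define A where "A = insert a (p ` ?N)"
  have Ac: "A \<subseteq> carrier R" using a(1) p ideal.Icarr[OF idP] by (auto simp: A_def)
  have "finite A" using \<open>finite ?N\<close> by (simp add: A_def)
  have AJ: "A \<subseteq> Idl A" by (rule genideal_self[OF Ac])
  have J: "ideal (Idl A) R" by (rule genideal_ideal[OF Ac])
  have "P \<subseteq> Idl A"
  proof
    fix y assume y: "y \<in> P"
    have yc: "y \<in> carrier R" using ideal.Icarr[OF idP y] .
    show "y \<in> Idl A"
    proof (rule mem_ideal_if_locally[OF J yc])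
      fix N assume max: "maximalideal N R" and JN: "Idl A \<subseteq> N"
      hence N: "primeideal N R" by (simp add: maximalideal_prime)
      have PN: "P \<subseteq> N"
      proof (rule ccontr)
        assume "\<not> P \<subseteq> N"
        hence "N \<in> ?N" using max AJ JN by (auto simp: A_def)
        thus False using p[of N] AJ JN unfolding A_def by blast
      qed
      \<comment> \<open>Contracting \<open>P\<close> at \<open>N \<supseteq> P\<close> gives nothing
        new. So \<open>a\<close> is not locally a multiple of \<open>y\<close>, and by comparability
        \<open>y\<close> is one of \<open>a\<close>.\<close>
      have "a \<notin> loc_contraction N P"
        using primeideal.I_prime[OF P] a PN by (blast elim: loc_contractionE)
      hence "a \<notin> loc_contraction N ((\<otimes>) y ` carrier R)"
        using loc_contraction_mono[OF mult_carrier_subset[OF idP y]] by blast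
      hence "y \<in> loc_contraction N ((\<otimes>) a ` carrier R)"
        using local_chain[OF N yc a(1)] by blast
      moreover have "(\<otimes>) a ` carrier R \<subseteq> Idl A"
        by (rule mult_carrier_subset[OF J]) (use AJ in \<open>auto simp: A_def\<close>)
      ultimately show "y \<in> loc_contraction N (Idl A)" using loc_contraction_mono by blast
    qed
  qed
  moreover have "Idl A \<subseteq> set_add R P (PIdl a)"
  proof (rule genideal_minimal)
    show "ideal (set_add R P (PIdl a)) R" by (rule add_ideals[OF idP cgenideal_ideal[OF a(1)]])
    have "x \<in> set_add R P (PIdl a)" if "x \<in> P" for x
    proof -
      have "x = x \<oplus> \<zero>" using that ideal.Icarr[OF idP] by simp
      thus ?thesis using that ideal_zero[OF cgenideal_ideal[OF a(1)]] by (auto simp: set_add_def')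
    qed
    moreover have "a \<in> set_add R P (PIdl a)"
    proof -
      have "a = \<zero> \<oplus> a" using a(1) by simp
      thus ?thesis using cgenideal_self[OF a(1)] ideal_zero[OF idP] unfolding set_add_def' by blast
    qed
    ultimately show "A \<subseteq> set_add R P (PIdl a)" using p by (auto simp: A_def)
  qed
  moreover have "finitely_generated_ideal R (Idl A)"
    using \<open>finite A\<close> Ac unfolding finitely_generated_ideal_def by blast
  ultimately show ?thesis using J AJ by (auto simp: A_def)
qed

text \<open>In the application \<open>x\<close> lies in the divisorial closure of \<open>P\<close>,
  which yields \<open>mem\<close> because finitely generated ideals are divisorial. Nonmaximality
  supplies \<open>m\<close>.\<close>

lemma mem_nonmaximal_prime:
  assumes P: "primeideal P R" "\<not> maximalideal P R" and fc: "finite_character R"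
    and x: "x \<in> carrier R"
    and mem: "\<And>J. \<lbrakk>ideal J R; finitely_generated_ideal R J; P \<subseteq> J\<rbrakk> \<Longrightarrow> x \<in> J"
  shows "x \<in> P"
proof (rule ccontr)
  assume xP: "x \<notin> P"
  have idP: "ideal P R" by (rule primeideal.axioms(1)[OF P(1)])
  have "P \<noteq> carrier R" using primeideal.I_notcarr[OF P(1)] by simp
  then obtain M where M: "maximalideal M R" "P \<subseteq> M" using exists_maximalideal[OF idP] by blast
  have idM: "ideal M R" by (rule maximalideal.axioms(1)[OF M(1)])
  have "M \<noteq> P" using M(1) P(2) by auto
  then obtain m where m: "m \<in> M" "m \<notin> P" using M(2) by blast
  have mc: "m \<in> carrier R" using ideal.Icarr[OF idM m(1)] .
  let ?a = "x \<otimes> m"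
  have a: "?a \<in> carrier R" "?a \<notin> P" using x mc prime_mult_notin[OF P(1) x xP mc m(2)] by auto
  have "PIdl ?a \<noteq> {\<zero>}" using cgenideal_self[OF a(1)] a(2) ideal_zero[OF idP] by auto
  hence "finite {N. maximalideal N R \<and> PIdl ?a \<subseteq> N}"
    using fc cgenideal_ideal[OF a(1)] by (auto simp: finite_character_def)
  hence "finite {N. maximalideal N R \<and> ?a \<in> N}"
    by (rule finite_subset[rotated]) (use cgenideal_minimal maximalideal.axioms(1) in blast)
  then obtain J where "ideal J R" "finitely_generated_ideal R J" "P \<subseteq> J" "J \<subseteq> set_add R P (PIdl ?a)"
    using finitely_generated_between[OF P(1) a] by blast
  hence "x \<in> set_add R P (PIdl ?a)" using mem by blast
  then obtain p d where pd: "p \<in> P" "d \<in> carrier R" "x = p \<oplus> d \<otimes> ?a"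
    by (auto simp: set_add_def' cgenideal_def)
  have pc: "p \<in> carrier R" using ideal.Icarr[OF idP pd(1)] .
  \<comment> \<open>Solving \<open>x = p + d x m\<close> for \<open>p\<close> isolates the factor
    \<open>1 - d m\<close>, which primeness puts into \<open>P\<close>.\<close>
  have "x \<otimes> (\<one> \<ominus> d \<otimes> m) = x \<ominus> d \<otimes> (x \<otimes> m)" using x mc pd(2) by algebra
  also have "\<dots> = (p \<oplus> d \<otimes> ?a) \<ominus> d \<otimes> ?a" using pd(3) by simp
  also have "\<dots> = p" using pc pd(2) a(1) by algebra
  finally have "x \<otimes> (\<one> \<ominus> d \<otimes> m) \<in> P" using pd(1) by simp
  hence dm: "\<one> \<ominus> d \<otimes> m \<in> P"
    using primeideal.I_prime[OF P(1) x, of "\<one> \<ominus> d \<otimes> m"] xP pd(2) mc by simp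
  have "(\<one> \<ominus> d \<otimes> m) \<oplus> d \<otimes> m \<in> M"
    by (rule ideal_add[OF idM]) (use dm M(2) ideal.I_l_closed[OF idM m(1) pd(2)] in auto)
  moreover have "(\<one> \<ominus> d \<otimes> m) \<oplus> d \<otimes> m = \<one>" using pd(2) mc by algebra
  ultimately show False using prime_one_notin[OF maximalideal_prime[OF M(1)]] by simp
qed

text \<open>For \<open>u = a / b\<close> this is \<open>(R : M) = R\<close> without denominators. If
  \<open>b\<close> does not divide \<open>a\<close>, then \<open>(b R : a) = M\<close>, and
  comparability gives \<open>e\<close> and \<open>g\<close> in \<open>M\<close> with
  \<open>g a = b (1 - e)\<close>. From \<open>g \<in> M\<^sup>2\<close> follows
  \<open>g a \<in> b M\<close>, so \<open>1 - e \<in> M\<close> as well.\<close>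

lemma dvd_if_idempotent_maximal_mult_dvd:
  assumes M: "maximalideal M R" "idempotent_ideal R M"
    and ab: "a \<in> carrier R" "b \<in> carrier R" "b \<noteq> \<zero>"
    and mult: "\<And>m. m \<in> M \<Longrightarrow> m \<otimes> a \<in> (\<otimes>) b ` carrier R"
  shows "a \<in> (\<otimes>) b ` carrier R"
proof (rule ccontr)
  assume notin: "a \<notin> (\<otimes>) b ` carrier R"
  have idM: "ideal M R" by (rule maximalideal.axioms(1)[OF M(1)])
  have Mc: "M \<subseteq> carrier R" using ideal.Icarr[OF idM] by blast
  let ?Q = "{y \<in> carrier R. y \<otimes> a \<in> (\<otimes>) b ` carrier R}"
  have Q: "ideal ?Q R"
    by (rule ideal_quotient_element[OF ideal_mult_image[OF oneideal ab(2)] ab(1)])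
  have MQ: "M \<subseteq> ?Q" using mult Mc by blast
  have "\<one> \<notin> ?Q" using notin ab(1) by simp
  hence "?Q = M" using maximalideal.I_maximal[OF M(1) Q MQ] one_closed by blast
  obtain e f g where e: "e \<in> carrier R" "f \<in> carrier R" "g \<in> carrier R"
    "e \<otimes> a = b \<otimes> f" "(\<one> \<ominus> e) \<otimes> b = a \<otimes> g"
    using compare[OF ab(1,2)] by blast
  have ga: "g \<otimes> a = b \<otimes> (\<one> \<ominus> e)" using e ab m_comm by simp
  have "e \<in> ?Q" using e by blast
  hence eM: "e \<in> M" using \<open>?Q = M\<close> by blast
  have "g \<in> ?Q" using e ga by blast
  hence gM: "g \<in> M" using \<open>?Q = M\<close> by blast
  let ?A = "{y \<in> carrier R. y \<otimes> a \<in> (\<otimes>) b ` M}"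
  have "ideal_prod R M M \<subseteq> ?A"
  proof (rule ideal_prod_subset[OF ideal_quotient_element[OF ideal_mult_image[OF idM ab(2)] ab(1)]])
    fix i j assume ij: "i \<in> M" "j \<in> M"
    obtain c where c: "c \<in> carrier R" "i \<otimes> a = b \<otimes> c" using mult[OF ij(1)] by blast
    have ic: "i \<in> carrier R" "j \<in> carrier R" using ij Mc by auto
    have "(i \<otimes> j) \<otimes> a = (i \<otimes> a) \<otimes> j" using ic ab(1) by algebra
    also have "\<dots> = b \<otimes> (c \<otimes> j)" unfolding c(2) using c(1) ic ab(2) by algebra
    finally have "(i \<otimes> j) \<otimes> a \<in> (\<otimes>) b ` M" using ideal.I_l_closed[OF idM ij(2) c(1)] by blast
    thus "i \<otimes> j \<in> ?A" using ic by simp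
  qed
  hence "g \<in> ?A" using gM M(2) by (auto simp: idempotent_ideal_def)
  then obtain z where z: "z \<in> M" "g \<otimes> a = b \<otimes> z" by blast
  have "b \<otimes> (\<one> \<ominus> e) = b \<otimes> z" using ga z(2) by simp
  hence "\<one> \<ominus> e \<in> M" using ab(2,3) e(1) z(1) Mc by (simp add: m_lcancel subset_iff)
  hence "(\<one> \<ominus> e) \<oplus> e \<in> M" using ideal_add[OF idM] eM by blast
  moreover have "(\<one> \<ominus> e) \<oplus> e = \<one>" using e(1) by algebra
  ultimately show False using prime_one_notin[OF maximalideal_prime[OF M(1)]] by simp
qed

end

subsection \<open>Divisorial ideals\<close>

context quotient_field
begin

lemma embed_closed [simp]: "x \<in> carrier R \<Longrightarrow> \<iota> x \<in> carrier K"
  by (rule ring_hom_closed[OF embed_hom])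

lemma embed_mult: "\<lbrakk>x \<in> carrier R; y \<in> carrier R\<rbrakk> \<Longrightarrow> \<iota> (x \<otimes> y) = \<iota> x \<otimes>\<^bsub>K\<^esub> \<iota> y"
  by (rule ring_hom_mult[OF embed_hom])

lemma embed_add: "\<lbrakk>x \<in> carrier R; y \<in> carrier R\<rbrakk> \<Longrightarrow> \<iota> (x \<oplus> y) = \<iota> x \<oplus>\<^bsub>K\<^esub> \<iota> y"
  by (rule ring_hom_add[OF embed_hom])

lemma embed_one: "\<iota> \<one> = \<one>\<^bsub>K\<^esub>"
  by (rule ring_hom_one[OF embed_hom])

lemma embed_eqD: "\<lbrakk>\<iota> x = \<iota> y; x \<in> carrier R; y \<in> carrier R\<rbrakk> \<Longrightarrow> x = y"
  by (rule inj_onD[OF embed_inj])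

lemma embed_zero: "\<iota> \<zero> = \<zero>\<^bsub>K\<^esub>"
  using embed_hom R.ring_axioms K.ring_axioms by (rule ring_hom_zero)

lemma embed_nonzero: "\<lbrakk>x \<in> carrier R; x \<noteq> \<zero>\<rbrakk> \<Longrightarrow> \<iota> x \<noteq> \<zero>\<^bsub>K\<^esub>"
  using embed_eqD[of x \<zero>] embed_zero by auto

lemma obtain_fraction:
  assumes "u \<in> carrier K"
  obtains a b where "a \<in> carrier R" "b \<in> carrier R" "b \<noteq> \<zero>" "u \<otimes>\<^bsub>K\<^esub> \<iota> b = \<iota> a"
proof -
  obtain a b where ab: "a \<in> carrier R" "b \<in> carrier R - {\<zero>}" "u = \<iota> a \<otimes>\<^bsub>K\<^esub> inv\<^bsub>K\<^esub> (\<iota> b)"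
    using fraction[OF assms] by blast
  have unit: "\<iota> b \<in> Units K" using ab(2) embed_nonzero by (simp add: K.field_Units)
  have "u \<otimes>\<^bsub>K\<^esub> \<iota> b = \<iota> a \<otimes>\<^bsub>K\<^esub> (inv\<^bsub>K\<^esub> (\<iota> b) \<otimes>\<^bsub>K\<^esub> \<iota> b)"
    using ab unit by (simp add: K.m_assoc)
  also have "\<dots> = \<iota> a" using ab(1) unit by simp
  finally show ?thesis using that ab(1,2) by blast
qed

lemma colon_in_carrier: "u \<in> colon R K \<iota> E \<Longrightarrow> u \<in> carrier K"
  by (simp add: colon_def)

lemma colonI:
  "\<lbrakk>u \<in> carrier K; \<And>e. e \<in> E \<Longrightarrow> u \<otimes>\<^bsub>K\<^esub> e \<in> \<iota> ` carrier R\<rbrakk> \<Longrightarrow> u \<in> colon R K \<iota> E"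
  by (simp add: colon_def)

lemma colonD: "\<lbrakk>u \<in> colon R K \<iota> E; e \<in> E\<rbrakk> \<Longrightarrow> u \<otimes>\<^bsub>K\<^esub> e \<in> \<iota> ` carrier R"
  by (simp add: colon_def)

lemma colon_antimono: "E \<subseteq> F \<Longrightarrow> colon R K \<iota> F \<subseteq> colon R K \<iota> E"
  by (auto simp: colon_def)

lemma one_in_colon: "I \<subseteq> carrier R \<Longrightarrow> \<one>\<^bsub>K\<^esub> \<in> colon R K \<iota> (\<iota> ` I)"
  by (auto intro!: colonI)

lemma colon_mult_closed:
  assumes "u \<in> colon R K \<iota> (\<iota> ` I)" "ideal I R" "x \<in> carrier R"
  shows "\<iota> x \<otimes>\<^bsub>K\<^esub> u \<in> colon R K \<iota> (\<iota> ` I)"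
proof (rule colonI)
  have u: "u \<in> carrier K" by (rule colon_in_carrier[OF assms(1)])
  show "\<iota> x \<otimes>\<^bsub>K\<^esub> u \<in> carrier K" using u assms(3) by simp
  fix e assume "e \<in> \<iota> ` I"
  then obtain i where i: "i \<in> I" "e = \<iota> i" by blast
  have ic: "i \<in> carrier R" using ideal.Icarr[OF assms(2) i(1)] .
  have "x \<otimes> i \<in> I" by (rule ideal.I_l_closed[OF assms(2) i(1) assms(3)])
  hence "u \<otimes>\<^bsub>K\<^esub> \<iota> (x \<otimes> i) \<in> \<iota> ` carrier R" by (intro colonD[OF assms(1)]) blast
  moreover have "u \<otimes>\<^bsub>K\<^esub> \<iota> (x \<otimes> i) = (\<iota> x \<otimes>\<^bsub>K\<^esub> u) \<otimes>\<^bsub>K\<^esub> e"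
    using u ic assms(3) i(2) by (simp add: embed_mult K.m_ac)
  ultimately show "(\<iota> x \<otimes>\<^bsub>K\<^esub> u) \<otimes>\<^bsub>K\<^esub> e \<in> \<iota> ` carrier R" by simp
qed

text \<open>As \<open>1 \<in> (R : I)\<close>, the divisorial closure lies in \<open>R\<close>, and
  it always contains \<open>I\<close>; one inclusion remains.\<close>

lemma divisorial_ideal_iff:
  assumes I: "ideal I R" "I \<noteq> {\<zero>}"
  shows "divisorial_ideal R K \<iota> I \<longleftrightarrow>
    (\<forall>x \<in> carrier R. \<iota> x \<in> colon R K \<iota> (colon R K \<iota> (\<iota> ` I)) \<longrightarrow> x \<in> I)" (is "_ \<longleftrightarrow> ?rhs")
proof -
  let ?V = "colon R K \<iota> (colon R K \<iota> (\<iota> ` I))"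
  have Ic: "I \<subseteq> carrier R" using ideal.Icarr[OF I(1)] by blast
  have "?V \<subseteq> \<iota> ` carrier R"
  proof
    fix v assume v: "v \<in> ?V"
    show "v \<in> \<iota> ` carrier R"
      using colonD[OF v one_in_colon[OF Ic]] colon_in_carrier[OF v] by simp
  qed
  moreover have "\<iota> ` I \<subseteq> ?V"
  proof
    fix v assume v: "v \<in> \<iota> ` I"
    hence vc: "v \<in> carrier K" using Ic by auto
    show "v \<in> ?V"
    proof (rule colonI[OF vc])
      fix u assume u: "u \<in> colon R K \<iota> (\<iota> ` I)"
      show "v \<otimes>\<^bsub>K\<^esub> u \<in> \<iota> ` carrier R"
        using colonD[OF u v] colon_in_carrier[OF u] vc K.m_comm by simp
    qed
  qed
  moreover have "\<iota> x \<in> \<iota> ` I \<longleftrightarrow> x \<in> I" if "x \<in> carrier R" for x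
    using that Ic embed_inj by (auto dest: inj_onD)
  ultimately show ?thesis unfolding divisorial_ideal_def using I by blast
qed

text \<open>From \<open>x (R : J) \<subseteq> R\<close> follows
  \<open>x J (R : J) \<subseteq> J\<close>, and \<open>J (R : J)\<close> contains \<open>1\<close>.
  Thus invertible ideals are divisorial.\<close>

lemma mem_invertible_ideal:
  assumes J: "invertible_ideal R K \<iota> J" and x: "x \<in> carrier R"
    and xJ: "\<iota> x \<in> colon R K \<iota> (colon R K \<iota> (\<iota> ` J))"
  shows "x \<in> J"
proof -
  have idJ: "ideal J R" and inv: "ideal_prod K (\<iota> ` J) (colon R K \<iota> (\<iota> ` J)) = \<iota> ` carrier R"
    using J by (auto simp: invertible_ideal_def)
  have "w \<in> carrier K \<and> w \<otimes>\<^bsub>K\<^esub> \<iota> x \<in> \<iota> ` J"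
    if "w \<in> ideal_prod K (\<iota> ` J) (colon R K \<iota> (\<iota> ` J))" for w
    using that
  proof induct
    case (prod i u)
    obtain j where j: "j \<in> J" "i = \<iota> j" using prod(1) by blast
    have jc: "j \<in> carrier R" using ideal.Icarr[OF idJ j(1)] .
    have u: "u \<in> carrier K" by (rule colon_in_carrier[OF prod(2)])
    obtain r where r: "r \<in> carrier R" "\<iota> x \<otimes>\<^bsub>K\<^esub> u = \<iota> r" using colonD[OF xJ prod(2)] by blast
    have "(i \<otimes>\<^bsub>K\<^esub> u) \<otimes>\<^bsub>K\<^esub> \<iota> x = i \<otimes>\<^bsub>K\<^esub> (\<iota> x \<otimes>\<^bsub>K\<^esub> u)"
      using j(2) jc u x by (simp add: K.m_ac)
    also have "\<dots> = \<iota> (j \<otimes> r)" using r jc j(2) by (simp add: embed_mult)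
    finally show ?case using ideal.I_r_closed[OF idJ j(1) r(1)] j(2) jc u by simp
  next
    case (sum v w)
    obtain a b where ab: "a \<in> J" "b \<in> J" "v \<otimes>\<^bsub>K\<^esub> \<iota> x = \<iota> a" "w \<otimes>\<^bsub>K\<^esub> \<iota> x = \<iota> b"
      using sum by blast
    have "(v \<oplus>\<^bsub>K\<^esub> w) \<otimes>\<^bsub>K\<^esub> \<iota> x = \<iota> (a \<oplus> b)"
      using sum ab ideal.Icarr[OF idJ] x by (simp add: K.l_distr embed_add)
    thus ?case using sum R.ideal_add[OF idJ ab(1,2)] by simp
  qed
  from this[of "\<one>\<^bsub>K\<^esub>"] have "\<iota> x \<in> \<iota> ` J"
    using inv embed_one R.one_closed x by (metis K.l_one embed_closed image_eqI)
  thus ?thesis using x embed_eqD ideal.Icarr[OF idJ] by blast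
qed

text \<open>\<open>J = a R + b R\<close> and \<open>(R : J)\<close> is an \<open>R\<close>-module,
  so sums of products collapse to two terms. Only \<open>w = 1\<close> is used later.\<close>

lemma ideal_prod_two_generators:
  assumes ab: "a \<in> carrier R" "b \<in> carrier R" and J: "J = Idl {a, b}"
    and w: "w \<in> ideal_prod K (\<iota> ` J) (colon R K \<iota> (\<iota> ` J))"
  shows "\<exists>u \<in> colon R K \<iota> (\<iota> ` J). \<exists>v \<in> colon R K \<iota> (\<iota> ` J).
    w = \<iota> a \<otimes>\<^bsub>K\<^esub> u \<oplus>\<^bsub>K\<^esub> \<iota> b \<otimes>\<^bsub>K\<^esub> v"
  using w
proof induct
  case (prod i k)
  have idJ: "ideal J R" unfolding J by (rule R.genideal_ideal) (use ab in simp)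
  let ?L = "set_add R (PIdl a) (PIdl b)"
  have "a = a \<oplus> \<zero> \<otimes> b" "b = \<zero> \<otimes> a \<oplus> b" using ab by simp_all
  hence "a \<in> ?L" "b \<in> ?L"
    using R.cgenideal_self[OF ab(1)] R.cgenideal_self[OF ab(2)] R.zero_closed
    unfolding set_add_def' cgenideal_def by blast+
  hence "J \<subseteq> ?L" unfolding J
    by (intro R.genideal_minimal R.add_ideals R.cgenideal_ideal ab) simp
  then obtain x y where xy: "x \<in> carrier R" "y \<in> carrier R" "i = \<iota> (x \<otimes> a \<oplus> y \<otimes> b)"
    using prod(1) unfolding set_add_def' cgenideal_def by blast
  have k: "k \<in> carrier K" by (rule colon_in_carrier[OF prod(2)])
  have "i \<otimes>\<^bsub>K\<^esub> k = \<iota> a \<otimes>\<^bsub>K\<^esub> (\<iota> x \<otimes>\<^bsub>K\<^esub> k) \<oplus>\<^bsub>K\<^esub> \<iota> b \<otimes>\<^bsub>K\<^esub> (\<iota> y \<otimes>\<^bsub>K\<^esub> k)"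
    using xy ab k by (simp add: embed_mult embed_add K.r_distr K.m_ac)
  thus ?case using colon_mult_closed[OF prod(2) idJ] xy(1,2) by blast
next
  case (sum s t)
  have idJ: "ideal J R" unfolding J by (rule R.genideal_ideal) (use ab in simp)
  obtain u v where uv: "u \<in> colon R K \<iota> (\<iota> ` J)" "v \<in> colon R K \<iota> (\<iota> ` J)"
      "s = \<iota> a \<otimes>\<^bsub>K\<^esub> u \<oplus>\<^bsub>K\<^esub> \<iota> b \<otimes>\<^bsub>K\<^esub> v"
    using sum(2) by blast
  obtain u' v' where uv': "u' \<in> colon R K \<iota> (\<iota> ` J)" "v' \<in> colon R K \<iota> (\<iota> ` J)"
      "t = \<iota> a \<otimes>\<^bsub>K\<^esub> u' \<oplus>\<^bsub>K\<^esub> \<iota> b \<otimes>\<^bsub>K\<^esub> v'"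
    using sum(4) by blast
  have add: "p \<oplus>\<^bsub>K\<^esub> q \<in> colon R K \<iota> (\<iota> ` J)"
    if pq: "p \<in> colon R K \<iota> (\<iota> ` J)" "q \<in> colon R K \<iota> (\<iota> ` J)" for p q
  proof (rule colonI)
    have c: "p \<in> carrier K" "q \<in> carrier K" using pq colon_in_carrier by auto
    thus "p \<oplus>\<^bsub>K\<^esub> q \<in> carrier K" by simp
    fix e assume e: "e \<in> \<iota> ` J"
    obtain x y where xy: "x \<in> carrier R" "y \<in> carrier R" "p \<otimes>\<^bsub>K\<^esub> e = \<iota> x" "q \<otimes>\<^bsub>K\<^esub> e = \<iota> y"
      using colonD[OF pq(1) e] colonD[OF pq(2) e] by blast
    have "e \<in> carrier K" using e ideal.Icarr[OF idJ] by auto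
    hence "(p \<oplus>\<^bsub>K\<^esub> q) \<otimes>\<^bsub>K\<^esub> e = \<iota> (x \<oplus> y)" using c xy by (simp add: K.l_distr embed_add)
    thus "(p \<oplus>\<^bsub>K\<^esub> q) \<otimes>\<^bsub>K\<^esub> e \<in> \<iota> ` carrier R" using xy(1,2) by simp
  qed
  have c: "u \<in> carrier K" "v \<in> carrier K" "u' \<in> carrier K" "v' \<in> carrier K"
    using uv(1,2) uv'(1,2) colon_in_carrier by auto
  have "s \<oplus>\<^bsub>K\<^esub> t = \<iota> a \<otimes>\<^bsub>K\<^esub> (u \<oplus>\<^bsub>K\<^esub> u') \<oplus>\<^bsub>K\<^esub> \<iota> b \<otimes>\<^bsub>K\<^esub> (v \<oplus>\<^bsub>K\<^esub> v')"
    unfolding uv(3) uv'(3) using c ab by (simp add: K.r_distr K.a_ac)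
  thus ?case using add[OF uv(1) uv'(1)] add[OF uv(2) uv'(2)] by blast
qed

end

text \<open>Invertibility gives \<open>1 = a u + b v\<close> with \<open>u\<close> and
  \<open>v\<close> in \<open>(R : J)\<close>. The products \<open>v b\<close>, \<open>v a\<close>,
  \<open>u b\<close>, \<open>u a\<close> lie in \<open>R\<close> and serve as \<open>e\<close>,
  \<open>f\<close>, \<open>g\<close>, \<open>1 - e\<close>.\<close>

sublocale pruefer_domain \<subseteq> arithmetical_domain R
proof unfold_locales
  fix a b assume ab: "a \<in> carrier R" "b \<in> carrier R"
  show "\<exists>e \<in> carrier R. \<exists>f \<in> carrier R. \<exists>g \<in> carrier R.
      e \<otimes> a = b \<otimes> f \<and> (\<one> \<ominus> e) \<otimes> b = a \<otimes> g"
  proof (cases "a = \<zero>")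
    case True
    \<comment> \<open>Here \<open>(a, b)\<close> may be zero and so not invertible;
      \<open>e = \<one>\<close> works directly.\<close>
    have "\<one> \<otimes> a = b \<otimes> \<zero> \<and> (\<one> \<ominus> \<one>) \<otimes> b = a \<otimes> \<zero>"
      using True ab by (simp add: a_minus_def R.r_neg)
    thus ?thesis using R.one_closed R.zero_closed by blast
  next
    case False
    define J where "J = Idl {a, b}"
    have sub: "{a, b} \<subseteq> J" unfolding J_def by (rule R.genideal_self) (use ab in simp)
    have idJ: "ideal J R" unfolding J_def by (rule R.genideal_ideal) (use ab in simp)
    have "J \<noteq> {\<zero>}" using sub False by blast
    moreover have "finitely_generated_ideal R J"
      unfolding finitely_generated_ideal_def J_def using ab by (intro exI[of _ "{a, b}"]) simp
    ultimately have "invertible_ideal R K \<iota> J" using fg_invertible idJ by blast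
    hence "\<one>\<^bsub>K\<^esub> \<in> ideal_prod K (\<iota> ` J) (colon R K \<iota> (\<iota> ` J))"
      using embed_one R.one_closed unfolding invertible_ideal_def by (metis imageI)
    then obtain u v where uv: "u \<in> colon R K \<iota> (\<iota> ` J)" "v \<in> colon R K \<iota> (\<iota> ` J)"
        "\<one>\<^bsub>K\<^esub> = \<iota> a \<otimes>\<^bsub>K\<^esub> u \<oplus>\<^bsub>K\<^esub> \<iota> b \<otimes>\<^bsub>K\<^esub> v"
      using ideal_prod_two_generators[OF ab J_def] by blast
    have c: "u \<in> carrier K" "v \<in> carrier K" using uv(1,2) colon_in_carrier by auto
    obtain h where h: "h \<in> carrier R" "u \<otimes>\<^bsub>K\<^esub> \<iota> a = \<iota> h" using colonD[OF uv(1), of "\<iota> a"] sub by blast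
    obtain e where e: "e \<in> carrier R" "v \<otimes>\<^bsub>K\<^esub> \<iota> b = \<iota> e" using colonD[OF uv(2), of "\<iota> b"] sub by blast
    obtain f where f: "f \<in> carrier R" "v \<otimes>\<^bsub>K\<^esub> \<iota> a = \<iota> f" using colonD[OF uv(2), of "\<iota> a"] sub by blast
    obtain g where g: "g \<in> carrier R" "u \<otimes>\<^bsub>K\<^esub> \<iota> b = \<iota> g" using colonD[OF uv(1), of "\<iota> b"] sub by blast
    have "\<iota> \<one> = \<iota> (h \<oplus> e)"
      using uv(3) h e c ab by (simp add: embed_one embed_add K.m_comm)
    hence "\<one> = h \<oplus> e" using embed_eqD h(1) e(1) by simp
    hence h': "\<one> \<ominus> e = h" using h(1) e(1) by (simp add: a_minus_def R.a_assoc R.r_neg)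
    have "\<iota> (e \<otimes> a) = \<iota> (b \<otimes> f)"
      using ab e(1) f(1) c by (simp add: embed_mult e(2)[symmetric] f(2)[symmetric] K.m_ac)
    hence "e \<otimes> a = b \<otimes> f" using embed_eqD ab e(1) f(1) by simp
    moreover have "\<iota> (h \<otimes> b) = \<iota> (a \<otimes> g)"
      using ab h(1) g(1) c by (simp add: embed_mult h(2)[symmetric] g(2)[symmetric] K.m_ac)
    hence "h \<otimes> b = a \<otimes> g" using embed_eqD ab h(1) g(1) by simp
    ultimately show ?thesis using e(1) f(1) g(1) h' by blast
  qed
qed

section \<open>Divisorial ideals of Pruefer domains\<close>

context pruefer_domain
begin

text \<open>Divisorial closure is monotone, and finitely generated \<open>J \<supseteq> P\<close>
  are invertible, hence closed. So the closure of \<open>P\<close> lies in each such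
  \<open>J\<close>.\<close>

lemma divisorial_if_nonmaximal_prime:
  assumes fc: "finite_character R" and P: "primeideal P R" "\<not> maximalideal P R" "P \<noteq> {\<zero>}"
  shows "divisorial_ideal R K \<iota> P"
proof -
  have idP: "ideal P R" by (rule primeideal.axioms(1)[OF P(1)])
  have "x \<in> P" if x: "x \<in> carrier R" "\<iota> x \<in> colon R K \<iota> (colon R K \<iota> (\<iota> ` P))" for x
  proof (rule mem_nonmaximal_prime[OF P(1,2) fc x(1)])
    fix J assume J: "ideal J R" "finitely_generated_ideal R J" "P \<subseteq> J"
    have "J \<noteq> {\<zero>}" using P(3) J(3) R.ideal_zero[OF idP] by blast
    hence "invertible_ideal R K \<iota> J" using fg_invertible J by blast
    moreover have "\<iota> x \<in> colon R K \<iota> (colon R K \<iota> (\<iota> ` J))"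
      using x(2) colon_antimono[OF colon_antimono[OF image_mono[OF J(3)]]] by blast
    ultimately show "x \<in> J" using mem_invertible_ideal x(1) by blast
  qed
  thus ?thesis using divisorial_ideal_iff[OF idP P(3)] by blast
qed

lemma colon_idempotent_maximal:
  assumes M: "maximalideal M R" "idempotent_ideal R M"
  shows "colon R K \<iota> (\<iota> ` M) \<subseteq> \<iota> ` carrier R"
proof
  fix u assume u: "u \<in> colon R K \<iota> (\<iota> ` M)"
  have uc: "u \<in> carrier K" by (rule colon_in_carrier[OF u])
  obtain a b where ab: "a \<in> carrier R" "b \<in> carrier R" "b \<noteq> \<zero>" "u \<otimes>\<^bsub>K\<^esub> \<iota> b = \<iota> a"
    using obtain_fraction[OF uc] by blast
  have "m \<otimes> a \<in> (\<otimes>) b ` carrier R" if m: "m \<in> M" for m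
  proof -
    have mc: "m \<in> carrier R" using ideal.Icarr[OF maximalideal.axioms(1)[OF M(1)] m] .
    obtain c where c: "c \<in> carrier R" "u \<otimes>\<^bsub>K\<^esub> \<iota> m = \<iota> c" using colonD[OF u] m by blast
    have "\<iota> (m \<otimes> a) = \<iota> (b \<otimes> c)"
      using ab(1,2) mc c(1) uc
      by (simp add: embed_mult ab(4)[symmetric] c(2)[symmetric] K.m_ac)
    hence "m \<otimes> a = b \<otimes> c" using embed_eqD ab(1,2) mc c(1) by simp
    thus ?thesis using c(1) by blast
  qed
  hence "a \<in> (\<otimes>) b ` carrier R"
    by (rule dvd_if_idempotent_maximal_mult_dvd[OF M ab(1-3)])
  then obtain c where c: "c \<in> carrier R" "a = b \<otimes> c" by blast
  have "\<iota> b \<otimes>\<^bsub>K\<^esub> u = \<iota> b \<otimes>\<^bsub>K\<^esub> \<iota> c"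
    using ab(2,4) c uc by (simp add: embed_mult K.m_comm)
  hence "u = \<iota> c" using K.m_lcancel[OF embed_nonzero[OF ab(2,3)]] ab(2) uc c(1) by simp
  thus "u \<in> \<iota> ` carrier R" using c(1) by blast
qed

text \<open>\<open>(R : M) = R\<close> gives \<open>jM \<subseteq> I \<Longrightarrow> j(R : I) \<subseteq> (R : M) = R\<close>, that is, \<open>j\<close> lies in the divisorial
  closure of \<open>I\<close>.\<close>

lemma mem_divisorial_if_idempotent_maximal_mult:
  assumes I: "divisorial_ideal R K \<iota> I" and M: "maximalideal M R" "idempotent_ideal R M"
    and j: "j \<in> carrier R" "\<And>m. m \<in> M \<Longrightarrow> j \<otimes> m \<in> I"
  shows "j \<in> I"
proof -
  have "\<iota> j \<in> colon R K \<iota> (colon R K \<iota> (\<iota> ` I))"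
  proof (rule colonI)
    show "\<iota> j \<in> carrier K" using j(1) by simp
    fix u assume u: "u \<in> colon R K \<iota> (\<iota> ` I)"
    have uc: "u \<in> carrier K" by (rule colon_in_carrier[OF u])
    have "\<iota> j \<otimes>\<^bsub>K\<^esub> u \<in> colon R K \<iota> (\<iota> ` M)"
    proof (rule colonI)
      show "\<iota> j \<otimes>\<^bsub>K\<^esub> u \<in> carrier K" using j(1) uc by simp
      fix e assume "e \<in> \<iota> ` M"
      then obtain m where m: "m \<in> M" "e = \<iota> m" by blast
      have mc: "m \<in> carrier R" using ideal.Icarr[OF maximalideal.axioms(1)[OF M(1)] m(1)] .
      have "(\<iota> j \<otimes>\<^bsub>K\<^esub> u) \<otimes>\<^bsub>K\<^esub> e = u \<otimes>\<^bsub>K\<^esub> \<iota> (j \<otimes> m)"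
        using j(1) mc uc m(2) by (simp add: embed_mult K.m_ac)
      thus "(\<iota> j \<otimes>\<^bsub>K\<^esub> u) \<otimes>\<^bsub>K\<^esub> e \<in> \<iota> ` carrier R" using colonD[OF u] j(2)[OF m(1)] by simp
    qed
    thus "\<iota> j \<otimes>\<^bsub>K\<^esub> u \<in> \<iota> ` carrier R" using colon_idempotent_maximal[OF M] by blast
  qed
  thus ?thesis using I j(1) divisorial_ideal_iff[of I] by (simp add: divisorial_ideal_def)
qed

text \<open>By monotonicity the closure of \<open>I\<close> lies in the closure of each
  \<open>P \<in> F\<close>, which is \<open>P\<close>.\<close>

lemma divisorial_Inter:
  assumes F: "\<And>P. P \<in> F \<Longrightarrow> divisorial_ideal R K \<iota> P"
    and I: "ideal I R" "I \<noteq> {\<zero>}" "I = carrier R \<inter> \<Inter>F"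
  shows "divisorial_ideal R K \<iota> I"
proof -
  have "x \<in> P" if x: "x \<in> carrier R" "\<iota> x \<in> colon R K \<iota> (colon R K \<iota> (\<iota> ` I))" and P: "P \<in> F" for x P
  proof -
    have "I \<subseteq> P" using I(3) P by blast
    hence "\<iota> x \<in> colon R K \<iota> (colon R K \<iota> (\<iota> ` P))"
      using x(2) colon_antimono[OF colon_antimono[OF image_mono]] by blast
    thus ?thesis using F[OF P] x(1) divisorial_ideal_iff[of P] by (simp add: divisorial_ideal_def)
  qed
  thus ?thesis using divisorial_ideal_iff[OF I(1,2)] I(3) by blast
qed

text \<open>If \<open>M\<close> were maximal, incomparability would give \<open>j \<notin> M\<close>
  in the product of the other factors. Then \<open>j M \<subseteq> I\<close>, and divisoriality of
  \<open>I\<close> yields \<open>j \<in> I \<subseteq> M\<close>.\<close>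

lemma nonmaximal_if_divisorial_ideal_prod_list:
  assumes I: "divisorial_ideal R K \<iota> I" "I = ideal_prod_list R Ps" and inc: "incomparable Ps"
    and Ps: "\<And>P. P \<in> set Ps \<Longrightarrow> primeideal P R \<and> idempotent_ideal R P"
    and M: "M \<in> set Ps"
  shows "\<not> maximalideal M R"
proof
  assume max: "maximalideal M R"
  have ids: "ideal P R" if "P \<in> set Ps" for P using that Ps primeideal.axioms(1) by blast
  have Mp: "primeideal M R" using Ps M by blast
  let ?Qs = "filter (\<lambda>P. P \<noteq> M) Ps"
  have "\<not> P \<subseteq> M" if P: "P \<in> set ?Qs" for P
  proof -
    obtain i j where "i < length Ps" "Ps ! i = P" "j < length Ps" "Ps ! j = M"
      using P M by (auto simp: in_set_conv_nth)
    moreover have "P \<noteq> M" using P by simp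
    ultimately show ?thesis using inc unfolding incomparable_def by metis
  qed
  hence "\<not> ideal_prod_list R ?Qs \<subseteq> M"
    using R.prime_divides_ideal_prod_list[OF Mp, of ?Qs] ids by auto
  then obtain j where j: "j \<in> ideal_prod_list R ?Qs" "j \<notin> M" by blast
  have jc: "j \<in> carrier R"
    by (rule ideal.Icarr[OF R.ideal_ideal_prod_list j(1)]) (use ids in simp)
  \<comment> \<open>As an intersection, \<open>I\<close> can be tested one factor at a time.\<close>
  have IP: "I = carrier R \<inter> \<Inter>(set Ps)"
    unfolding I(2) by (rule ideal_prod_list_eq_Inter) (use Ps ids in blast)
  have "j \<otimes> m \<in> I" if m: "m \<in> M" for m
  proof -
    have mc: "m \<in> carrier R" using ideal.Icarr[OF ids[OF M] m] .
    have "j \<otimes> m \<in> P" if P: "P \<in> set Ps" for P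
    proof (cases "P = M")
      case True
      thus ?thesis using ideal.I_l_closed[OF ids[OF M] m jc] by simp
    next
      case False
      hence "ideal_prod_list R ?Qs \<subseteq> P"
        by (intro R.ideal_prod_list_subset) (use ids P in auto)
      hence "j \<in> P" using j(1) by blast
      thus ?thesis by (rule ideal.I_r_closed[OF ids[OF P] _ mc])
    qed
    thus ?thesis using IP jc mc by simp
  qed
  hence "j \<in> I"
    using Ps M by (intro mem_divisorial_if_idempotent_maximal_mult[OF I(1) max _ jc]) auto
  thus False using IP M j(2) by blast
qed

end

section \<open>Characterizations of idempotent and of idempotent divisorial ideals\<close>

theorem theorem3p5:
  fixes R :: "('a, 'm) ring_scheme" and K :: "('b, 'n) ring_scheme"
    and \<iota> :: "'a \<Rightarrow> 'b" and I :: "'a set"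
  assumes "pruefer_domain R K \<iota>"
    and "finite_character R"
    and "ideal I R" and "I \<noteq> {\<zero>\<^bsub>R\<^esub>}"
  defines "a \<equiv> idempotent_ideal R I \<and> divisorial_ideal R K \<iota> I"
    and "b \<equiv> \<exists>Ps. (\<forall>P \<in> set Ps. primeideal P R \<and> idempotent_ideal R P \<and> \<not> maximalideal P R)
                 \<and> I = ideal_prod_list R Ps"
    and "c \<equiv> \<exists>Ps. (\<forall>P \<in> set Ps. primeideal P R \<and> idempotent_ideal R P \<and> divisorial_ideal R K \<iota> P)
                 \<and> I = ideal_prod_list R Ps"
    and "d \<equiv> (\<exists>Ps. incomparable_div_idem_prime_rep R K \<iota> I Ps)
           \<and> (\<forall>Ps Qs. incomparable_div_idem_prime_rep R K \<iota> I Ps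
                    \<and> incomparable_div_idem_prime_rep R K \<iota> I Qs \<longrightarrow> mset Ps = mset Qs)"
  shows "(idempotent_ideal R I \<longleftrightarrow>
            (\<exists>Ps. (\<forall>P \<in> set Ps. primeideal P R \<and> idempotent_ideal R P)
                  \<and> I = ideal_prod_list R Ps))
       \<and> (a \<longleftrightarrow> b) \<and> (b \<longleftrightarrow> c) \<and> (c \<longleftrightarrow> d)"
proof -
  interpret pruefer_domain R K \<iota> by fact
  have fc: "finite_character R" and idI: "ideal I R" and I0: "I \<noteq> {\<zero>\<^bsub>R\<^esub>}" by fact+
  have decomposition: "\<exists>Ps. incomparable Ps \<and> (\<forall>P \<in> set Ps. primeideal P R \<and> idempotent_ideal R P)
      \<and> I = ideal_prod_list R Ps" if I: "idempotent_ideal R I"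
  proof -
    have "finite {M. maximalideal M R \<and> I \<subseteq> M}"
      using fc idI I0 by (simp add: finite_character_def)
    then obtain F where F: "finite F" "\<forall>P \<in> F. primeideal P R \<and> idempotent_ideal R P"
        "I = carrier R \<inter> \<Inter>F"
      using idempotent_eq_Inter_primes[OF I] by blast
    have "\<exists>Ps. set Ps \<subseteq> F \<and> incomparable Ps \<and> I = ideal_prod_list R Ps"
      by (rule R.incomparable_ideal_prod_list_of_Inter[OF I F(3,1)])
        (use F(2) primeideal.axioms(1) in blast)
    thus ?thesis using F(2) by blast
  qed
  \<comment> \<open>Divisorial ideals are nonzero by definition; the factors inherit this from
    \<open>I\<close>.\<close>
  have nonzero: "P \<noteq> {\<zero>\<^bsub>R\<^esub>}"
    if Ps: "\<And>P. P \<in> set Ps \<Longrightarrow> primeideal P R" "I = ideal_prod_list R Ps" and P: "P \<in> set Ps" for P Ps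
  proof -
    have "I \<subseteq> P"
      unfolding Ps(2) by (rule R.ideal_prod_list_subset[OF primeideal.axioms(1)[OF Ps(1)] P])
    thus ?thesis using I0 R.ideal_zero[OF idI] by blast
  qed
  have idempotent: "idempotent_ideal R I"
    if "\<And>P. P \<in> set Ps \<Longrightarrow> idempotent_ideal R P" "I = ideal_prod_list R Ps" for Ps
    using R.idempotent_ideal_prod_list that by blast
  \<comment> \<open>Incomparability is kept so that the same list also yields the representation in
    \<open>d\<close>.\<close>
  have rep: "\<exists>Ps. incomparable Ps \<and> (\<forall>P \<in> set Ps. primeideal P R \<and> idempotent_ideal R P
      \<and> \<not> maximalideal P R) \<and> I = ideal_prod_list R Ps" if ha: a
  proof -
    have I: "idempotent_ideal R I" "divisorial_ideal R K \<iota> I" using ha by (auto simp: a_def)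
    obtain Ps where Ps: "incomparable Ps" "I = ideal_prod_list R Ps"
        "\<And>P. P \<in> set Ps \<Longrightarrow> primeideal P R \<and> idempotent_ideal R P"
      using decomposition[OF I(1)] by blast
    have "\<not> maximalideal P R" if "P \<in> set Ps" for P
      by (rule nonmaximal_if_divisorial_ideal_prod_list[OF I(2) Ps(2,1,3) that])
    thus ?thesis using Ps by blast
  qed
  have divisorial: "divisorial_ideal R K \<iota> P"
    if "\<And>P. P \<in> set Ps \<Longrightarrow> primeideal P R" "I = ideal_prod_list R Ps" "P \<in> set Ps"
      "\<not> maximalideal P R" for P Ps
    using divisorial_if_nonmaximal_prime[OF fc that(1)[OF that(3)] that(4) nonzero[OF that(1-3)]] .
  have 1: "idempotent_ideal R I \<longleftrightarrow>
      (\<exists>Ps. (\<forall>P \<in> set Ps. primeideal P R \<and> idempotent_ideal R P) \<and> I = ideal_prod_list R Ps)"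
    using decomposition idempotent by blast
  have ab: b if a using rep[OF that] unfolding b_def by blast
  have bc: c if hb: b
  proof -
    obtain Ps where Ps: "\<And>P. P \<in> set Ps \<Longrightarrow> primeideal P R \<and> idempotent_ideal R P \<and> \<not> maximalideal P R"
        "I = ideal_prod_list R Ps" using hb unfolding b_def by blast
    have "divisorial_ideal R K \<iota> P" if "P \<in> set Ps" for P
      by (rule divisorial[OF _ Ps(2) that]) (use Ps(1) that in auto)
    thus ?thesis unfolding c_def using Ps by blast
  qed
  have ca: a if hc: c
  proof -
    obtain Ps where Ps: "\<And>P. P \<in> set Ps \<Longrightarrow> primeideal P R \<and> idempotent_ideal R P \<and> divisorial_ideal R K \<iota> P"
        "I = ideal_prod_list R Ps" using hc unfolding c_def by blast
    have "I = carrier R \<inter> \<Inter>(set Ps)"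
      unfolding Ps(2) by (rule ideal_prod_list_eq_Inter) (use Ps(1) primeideal.axioms(1) in blast)
    hence "divisorial_ideal R K \<iota> I" using Ps(1) divisorial_Inter[OF _ idI I0, of "set Ps"] by blast
    thus ?thesis unfolding a_def using idempotent Ps by blast
  qed
  \<comment> \<open>The factors given by \<open>c\<close> may be comparable; the detour through
    \<open>a\<close> replaces them by incomparable nonmaximal primes, which are divisorial.\<close>
  have cd: d if hc: c
  proof -
    obtain Ps where Ps: "incomparable Ps" "I = ideal_prod_list R Ps"
        "\<And>P. P \<in> set Ps \<Longrightarrow> primeideal P R \<and> idempotent_ideal R P \<and> \<not> maximalideal P R"
      using rep[OF ca[OF hc]] by blast
    have "divisorial_ideal R K \<iota> P" if "P \<in> set Ps" for P
      by (rule divisorial[OF _ Ps(2) that]) (use Ps(3) that in auto)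
    hence "incomparable_div_idem_prime_rep R K \<iota> I Ps"
      unfolding incomparable_div_idem_prime_rep_def using Ps by blast
    moreover have "mset Xs = mset Ys"
      if "incomparable_div_idem_prime_rep R K \<iota> I Xs" "incomparable_div_idem_prime_rep R K \<iota> I Ys" for Xs Ys
      by (rule R.incomparable_primes_unique)
        (use that in \<open>auto simp: incomparable_div_idem_prime_rep_def\<close>)
    ultimately show ?thesis unfolding d_def by blast
  qed
  have dc: c if d using that unfolding c_def d_def incomparable_div_idem_prime_rep_def by blast
  show ?thesis using 1 ab bc ca cd dc by blast
qed

end
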